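(* Let $t\ge1$ and let $n$ be a positive integer divisible by at least $2t$ distinct primes congruent to $3\pmod 4$. Then the deficiency of the maximal real subfield $\mathbb{Q}(\zeta_n)^+$ of the cyclotomic field of $n$th roots of unity is at least $t$. In particular, the deficiency of real cyclotomic fields can be arbitrarily large.
   Context: For a totally real field $F$ of degree $n$ and $0\neq\alpha\in F$, the signature of $\alpha$ is the vector in $\mathbb{F}_2^n$ whose entry at a real embedding $v$ is $0$ if $v(\alpha)>0$ and $1$ if $v(\alpha)<0$. The signatures of the units of $F$ form a subspace of $\mathbb{F}_2^n$ whose dimension is the unit signature rank of $F$; the deficiency $\delta(F)$ is $n$ minus the unit signature rank, which equals the $\mathbb{F}_2$-rank of the group of totally positive units of $F$ modulo squares of units. *)

theory Defs
  imports "HOL-Computational_Algebra.Polynomial" "HOL-Library.Z2" "HOL-Number_Theory.Cong" "HOL-Library.Function_Algebras"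
begin

definition cyclotomic_field :: "nat \<Rightarrow> complex set" where
  "cyclotomic_field n =
     {z. \<exists>p :: rat poly. z = poly (map_poly of_rat p) (cis (2 * pi / real n))}"

definition real_cyclotomic_field :: "nat \<Rightarrow> complex set" where
  "real_cyclotomic_field n = cyclotomic_field n \<inter> \<real>"

text \<open>Real embeddings of a number field \<open>F \<subseteq> \<complex>\<close>: ring homomorphisms \<open>F \<rightarrow> \<real>\<close>
  (taken extensional, i.e. 0 outside F, so that distinct embeddings are distinct functions).\<close>
definition real_embeddings :: "complex set \<Rightarrow> (complex \<Rightarrow> real) set" where
  "real_embeddings F =
     {\<sigma>. (\<forall>x\<in>F. \<forall>y\<in>F. \<sigma> (x + y) = \<sigma> x + \<sigma> y \<and> \<sigma> (x * y) = \<sigma> x * \<sigma> y)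
        \<and> \<sigma> 1 = 1 \<and> (\<forall>x. x \<notin> F \<longrightarrow> \<sigma> x = 0)}"

definition units_of_field :: "complex set \<Rightarrow> complex set" where
  "units_of_field F = {u \<in> F. u \<noteq> 0 \<and> algebraic_int u \<and> algebraic_int (1 / u)}"

definition signature :: "complex set \<Rightarrow> complex \<Rightarrow> (complex \<Rightarrow> real) \<Rightarrow> bit" where
  "signature F \<alpha> = (\<lambda>\<sigma>. if \<sigma> \<in> real_embeddings F \<and> \<sigma> \<alpha> < 0 then 1 else 0)"

definition bit_scale :: "bit \<Rightarrow> ((complex \<Rightarrow> real) \<Rightarrow> bit) \<Rightarrow> ((complex \<Rightarrow> real) \<Rightarrow> bit)" where
  "bit_scale c v = (\<lambda>\<sigma>. c * v \<sigma>)"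

definition unit_signature_rank :: "complex set \<Rightarrow> nat" where
  "unit_signature_rank F = vector_space.dim bit_scale (signature F ` units_of_field F)"

text \<open>Deficiency: degree (= number of real embeddings, F totally real) minus unit signature rank.\<close>
definition deficiency :: "complex set \<Rightarrow> nat" where
  "deficiency F = card (real_embeddings F) - unit_signature_rank F"

end

theory Submission
  imports Defs "Jordan_Normal_Form.Char_Poly" "HOL-Number_Theory.Quadratic_Reciprocity"
    "HOL-Computational_Algebra.Nth_Powers"
begin

text \<open>
  Write \<open>K = \<rat>(\<zeta>\<^sub>n)\<^sup>+\<close>. It suffices to find \<open>t\<close> independent linear functionals on
  \<open>\<bbbF>\<^sub>2\<close>-valued functions on the embeddings that kill all unit signatures. By quadratic reciprocity
  the residue relation is a tournament on the primes congruent to 3 modulo 4, so among \<open>2 t\<close> of them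
  some \<open>q\<close> admits \<open>t\<close> others \<open>p\<^sub>1, \<dots>, p\<^sub>t\<close> that are squares modulo \<open>q\<close>.

  One functional is the sign of the norm: it is trivial, as \<open>\<rat>(\<surd>(p\<^sub>1 q)) \<subseteq> K\<close> has no element of norm
  \<open>-1\<close> and integral trace. The others are, for \<open>i > 1\<close>, the sign of the norm \<open>v\<close> to \<open>k = \<rat>(\<surd>d)\<close>,
  \<open>d = p\<^sub>1 p\<^sub>i\<close>, at one real place. A unit \<open>v\<close> of \<open>k\<close> of norm 1 is a square times \<open>2 + tr v\<close>, which is
  \<open>\<plusminus>c\<close> times a rational square with \<open>c\<close> dividing \<open>d\<close>. Since \<open>v\<close> is also a norm from
  \<open>k(\<surd>(q p\<^sub>1)) \<subseteq> K\<close>, a negative \<open>v\<close> would make \<open>-c\<close> a value of \<open>x\<^sup>2 - q p\<^sub>1 y\<^sup>2\<close> over \<open>k\<close>; but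
  \<open>-c\<close> is not a square modulo the primes of \<open>k\<close> above \<open>q\<close>, which split. The functionals are independent
  because no nonempty product of the \<open>\<surd>(p\<^sub>1 p\<^sub>i)\<close> is rational.
\<close>

section \<open>Sums and products of algebraic integers\<close>

text \<open>The \<open>b i\<close> form an eigenvector of the integer matrix \<open>c\<close> for
  the eigenvalue \<open>x\<close>, so \<open>x\<close> is a root of its characteristic polynomial,
  which is monic with integer coefficients.\<close>

lemma algebraic_int_of_integer_system:
  fixes x :: "'a :: field_char_0"
  assumes fin: "finite I"
    and eq: "\<And>i. i \<in> I \<Longrightarrow> x * b i = (\<Sum>j\<in>I. of_int (c i j) * b j)"
    and nz: "\<exists>i\<in>I. b i \<noteq> 0"
  shows "algebraic_int x"
proof -
  define N where "N = card I"
  obtain f where f: "bij_betw f {..<N} I"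
    using ex_bij_betw_nat_finite[OF fin] by (auto simp: N_def atLeast0LessThan)
  define A where "A = Matrix.mat N N (\<lambda>(k, l). c (f k) (f l))"
  define w where "w = Matrix.vec N (\<lambda>k. b (f k))"
  have A: "A \<in> carrier_mat N N" by (simp add: A_def)
  let ?B = "of_int_hom.mat_hom A :: 'a mat"
  have B: "?B \<in> carrier_mat N N" using A by simp
  have fI: "f k \<in> I" if "k < N" for k using f that by (auto simp: bij_betw_def)
  have "?B *\<^sub>v w = x \<cdot>\<^sub>v w"
  proof (rule eq_vecI)
    fix k assume "k < dim_vec (x \<cdot>\<^sub>v w)"
    hence k: "k < N" by (simp add: w_def)
    have "(?B *\<^sub>v w) $ k = (\<Sum>l = 0..<N. of_int (c (f k) (f l)) * b (f l))"
      using k by (simp add: A_def w_def scalar_prod_def)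
    also have "\<dots> = (\<Sum>j\<in>I. of_int (c (f k) j) * b j)"
      using sum.reindex_bij_betw[OF f, of "\<lambda>j. of_int (c (f k) j) * b j"]
      by (simp add: atLeast0LessThan)
    also have "\<dots> = x * b (f k)" using eq[OF fI[OF k]] by simp
    finally show "(?B *\<^sub>v w) $ k = (x \<cdot>\<^sub>v w) $ k" using k by (simp add: w_def)
  qed (simp add: w_def A_def)
  moreover have "w \<noteq> 0\<^sub>v N"
  proof
    assume w0: "w = 0\<^sub>v N"
    have "b (f k) = 0" if "k < N" for k
      using arg_cong[OF w0, of "\<lambda>v. v $ k"] that by (simp add: w_def)
    moreover from nz obtain i where i: "i \<in> I" "b i \<noteq> 0" by auto
    moreover obtain k where "k < N" "f k = i" using f i by (auto simp: bij_betw_def)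
    ultimately show False by blast
  qed
  ultimately have "eigenvalue ?B x"
    unfolding eigenvalue_def eigenvector_def using B by (intro exI[of _ w]) (auto simp: w_def)
  hence "poly (char_poly ?B) x = 0" using eigenvalue_root_char_poly[OF B] by simp
  hence "poly (of_int_poly (char_poly A)) x = 0"
    using of_int_hom.char_poly_hom[OF A, where ?'a = 'a] by simp
  moreover have "monic (char_poly A)" using degree_monic_char_poly[OF A] by simp
  ultimately show ?thesis unfolding algebraic_int_altdef_ipoly by blast
qed

text \<open>Multiplication by \<open>x\<close> shifts the powers below the degree of a monic integer
  polynomial killing \<open>x\<close>, and that polynomial rewrites the top power: \<open>c\<close>
  is a companion matrix. The bound \<open>d > 0\<close> keeps \<open>x ^ 0 = 1\<close> among the
  basis vectors.\<close>

lemma algebraic_int_power_system: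
  fixes x :: "'a :: field_char_0"
  assumes "algebraic_int x"
  obtains d c where "d > 0" "\<And>i. i < d \<Longrightarrow> x * x ^ i = (\<Sum>j<d. of_int (c i j) * x ^ j)"
proof -
  from assms obtain p where p: "poly (of_int_poly p) x = 0" "monic p"
    unfolding algebraic_int_altdef_ipoly by blast
  define d where "d = degree p"
  define c where "c = (\<lambda>i j. if Suc i = d then - Polynomial.coeff p j else if j = Suc i then 1 else 0)"
  have "d > 0"
  proof (rule ccontr)
    assume "\<not> d > 0"
    with p(2) have "p = 1" by (simp add: d_def monic_degree_0)
    with p(1) show False by simp
  qed
  moreover have "x * x ^ i = (\<Sum>j<d. of_int (c i j) * x ^ j)" if "i < d" for i
  proof (cases "Suc i = d")
    case True
    have deg: "degree (of_int_poly p :: 'a poly) = d" by (simp add: d_def)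
    have "0 = (\<Sum>j\<le>d. of_int (Polynomial.coeff p j) * x ^ j)"
      using p(1) unfolding poly_altdef deg by simp
    also have "\<dots> = (\<Sum>j<d. of_int (Polynomial.coeff p j) * x ^ j) + x ^ d"
      using p(2) by (simp add: lessThan_Suc_atMost[symmetric] d_def)
    finally have "x ^ d = - (\<Sum>j<d. of_int (Polynomial.coeff p j) * x ^ j)"
      by (simp add: eq_neg_iff_add_eq_0 add.commute)
    with True show ?thesis by (simp add: c_def sum_negf flip: True)
  next
    case False
    hence "Suc i < d" using that by simp
    have "(\<Sum>j<d. of_int (c i j) * x ^ j) = (\<Sum>j<d. if j = Suc i then x ^ j else 0)"
      using False by (intro sum.cong) (auto simp: c_def)
    also have "\<dots> = x ^ Suc i" using \<open>Suc i < d\<close> by simp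
    finally show ?thesis by simp
  qed
  ultimately show ?thesis by (rule that)
qed

text \<open>The finitely many monomials \<open>x ^ i * y ^ j\<close> span a module over the integers
  that is stable under \<open>x\<close> and under \<open>y\<close>; it contains 1, so the system is
  not trivial.\<close>

lemma
  fixes x y :: "'a :: field_char_0"
  assumes "algebraic_int x" "algebraic_int y"
  shows algebraic_int_add: "algebraic_int (x + y)"
    and algebraic_int_mult: "algebraic_int (x * y)"
proof -
  obtain d c where d: "d > 0" "\<And>i. i < d \<Longrightarrow> x * x ^ i = (\<Sum>j<d. of_int (c i j) * x ^ j)"
    using algebraic_int_power_system[OF assms(1)] by metis
  obtain e g where e: "e > 0" "\<And>i. i < e \<Longrightarrow> y * y ^ i = (\<Sum>j<e. of_int (g i j) * y ^ j)"
    using algebraic_int_power_system[OF assms(2)] by metis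
  define b where "b = (\<lambda>(i, j). x ^ i * y ^ j)"
  define I where "I = {..<d} \<times> {..<e}"
  have fin: "finite I" by (simp add: I_def)
  have nz: "\<exists>p\<in>I. b p \<noteq> 0" using d(1) e(1) by (intro bexI[of _ "(0, 0)"]) (auto simp: I_def b_def)
  show "algebraic_int (x + y)"
  proof (rule algebraic_int_of_integer_system[OF fin _ nz])
    fix p assume "p \<in> I"
    then obtain i j where p: "p = (i, j)" "i < d" "j < e" by (auto simp: I_def)
    \<comment> \<open>The matrix is the Kronecker sum of the two companion matrices; for
      \<open>x * y\<close> below it is their Kronecker product.\<close>
    have "(\<Sum>r\<in>I. of_int ((if snd r = j then c i (fst r) else 0) + (if fst r = i then g j (snd r) else 0)) * b r)
        = (\<Sum>k<d. \<Sum>l<e. (if l = j then of_int (c i k) * x ^ k * y ^ l else 0)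
            + (if k = i then of_int (g j l) * x ^ k * y ^ l else 0))"
      unfolding I_def sum.cartesian_product by (intro sum.cong) (auto simp: b_def algebra_simps)
    also have "\<dots> = (\<Sum>k<d. of_int (c i k) * x ^ k * y ^ j) + (\<Sum>l<e. of_int (g j l) * x ^ i * y ^ l)"
      using p by (simp add: sum.distrib) (simp add: sum.swap[of _ "{..<e}" "{..<d}"])
    also have "\<dots> = x * x ^ i * y ^ j + y * y ^ j * x ^ i"
      unfolding d(2)[OF p(2)] e(2)[OF p(3)] by (simp add: sum_distrib_right sum_distrib_left mult_ac)
    also have "\<dots> = (x + y) * b p" by (simp add: p b_def algebra_simps)
    finally show "(x + y) * b p = (\<Sum>r\<in>I. of_int ((if snd r = snd p then c (fst p) (fst r) else 0)
        + (if fst r = fst p then g (snd p) (snd r) else 0)) * b r)"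
      by (simp only: p fst_conv snd_conv)
  qed
  show "algebraic_int (x * y)"
  proof (rule algebraic_int_of_integer_system[OF fin _ nz])
    fix p assume "p \<in> I"
    then obtain i j where p: "p = (i, j)" "i < d" "j < e" by (auto simp: I_def)
    have "(\<Sum>r\<in>I. of_int (c i (fst r) * g j (snd r)) * b r)
        = (\<Sum>k<d. \<Sum>l<e. (of_int (c i k) * x ^ k) * (of_int (g j l) * y ^ l))"
      unfolding I_def sum.cartesian_product by (intro sum.cong) (auto simp: b_def algebra_simps)
    also have "\<dots> = (x * x ^ i) * (y * y ^ j)"
      unfolding d(2)[OF p(2)] e(2)[OF p(3)] by (simp add: sum_product)
    finally show "(x * y) * b p = (\<Sum>r\<in>I. of_int (c (fst p) (fst r) * g (snd p) (snd r)) * b r)"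
      by (simp add: p b_def algebra_simps)
  qed
qed

lemma algebraic_int_prod:
  fixes f :: "'b \<Rightarrow> 'a :: field_char_0"
  assumes "\<And>i. i \<in> A \<Longrightarrow> algebraic_int (f i)"
  shows "algebraic_int (prod f A)"
  using assms by (induction A rule: infinite_finite_induct)
    (auto intro: algebraic_int_mult int_imp_algebraic_int)

section \<open>Embeddings of a totally real Galois field\<close>

abbreviation rat_eval :: "rat poly \<Rightarrow> complex \<Rightarrow> complex" where
  "rat_eval p x \<equiv> poly (map_poly of_rat p) x"

text \<open>Only the ring of polynomial values; closure under inverses is proved for the fields
  considered here in \<open>K_inverse\<close>.\<close>

definition rat_adjoin :: "complex \<Rightarrow> complex set" where
  "rat_adjoin \<theta> = range (\<lambda>p. rat_eval p \<theta>)"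

interpretation rat_complex_poly: map_poly_comm_ring_hom "of_rat :: rat \<Rightarrow> complex" ..

lemma map_poly_of_rat_pCons:
  "map_poly of_rat (pCons c p) = pCons (of_rat c) (map_poly of_rat p :: complex poly)"
  by (intro poly_eqI) (auto simp: coeff_map_poly coeff_pCons split: nat.split)

lemma rat_eval_simps [simp]:
  "rat_eval (p + q) x = rat_eval p x + rat_eval q x"
  "rat_eval (p * q) x = rat_eval p x * rat_eval q x"
  "rat_eval (p - q) x = rat_eval p x - rat_eval q x"
  "rat_eval [:c:] x = of_rat c"
  "rat_eval (pCons c p) x = of_rat c + x * rat_eval p x"
  by (simp_all add: rat_complex_poly.hom_mult rat_complex_poly.hom_minus rat_complex_poly.hom_add map_poly_of_rat_pCons)

lemma of_rat_complex: "(of_rat c :: complex) = complex_of_real (of_rat c)"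
  by (cases c) (simp add: of_rat_rat)

lemma rat_adjoin_generator: "\<theta> \<in> rat_adjoin \<theta>"
  unfolding rat_adjoin_def by (rule range_eqI[of _ _ "[:0, 1:]"]) simp

lemma rat_adjoin_of_rat: "of_rat c \<in> rat_adjoin \<theta>"
  unfolding rat_adjoin_def by (rule range_eqI[of _ _ "[:c:]"]) simp

lemma rat_adjoin_add: "x \<in> rat_adjoin \<theta> \<Longrightarrow> y \<in> rat_adjoin \<theta> \<Longrightarrow> x + y \<in> rat_adjoin \<theta>"
  unfolding rat_adjoin_def by (auto simp flip: rat_eval_simps(1))

lemma rat_adjoin_mult: "x \<in> rat_adjoin \<theta> \<Longrightarrow> y \<in> rat_adjoin \<theta> \<Longrightarrow> x * y \<in> rat_adjoin \<theta>"
  unfolding rat_adjoin_def by (auto simp flip: rat_eval_simps(2))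

lemma rat_adjoin_0 [simp]: "0 \<in> rat_adjoin \<theta>" and rat_adjoin_1 [simp]: "1 \<in> rat_adjoin \<theta>"
  using rat_adjoin_of_rat[of 0] rat_adjoin_of_rat[of 1] by simp_all

lemma rat_adjoin_uminus: "x \<in> rat_adjoin \<theta> \<Longrightarrow> - x \<in> rat_adjoin \<theta>"
  using rat_adjoin_mult[OF rat_adjoin_of_rat[of "-1"], of x] by (simp add: of_rat_minus)

lemma rat_adjoin_diff: "x \<in> rat_adjoin \<theta> \<Longrightarrow> y \<in> rat_adjoin \<theta> \<Longrightarrow> x - y \<in> rat_adjoin \<theta>"
  using rat_adjoin_add[OF _ rat_adjoin_uminus, of x \<theta> y] by simp

lemma rat_adjoin_sum: "(\<And>i. i \<in> A \<Longrightarrow> f i \<in> rat_adjoin \<theta>) \<Longrightarrow> sum f A \<in> rat_adjoin \<theta>"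
  by (induction A rule: infinite_finite_induct) (auto intro: rat_adjoin_add)

lemma rat_adjoin_prod: "(\<And>i. i \<in> A \<Longrightarrow> f i \<in> rat_adjoin \<theta>) \<Longrightarrow> prod f A \<in> rat_adjoin \<theta>"
  by (induction A rule: infinite_finite_induct) (auto intro: rat_adjoin_mult)

lemma rat_adjoin_power: "x \<in> rat_adjoin \<theta> \<Longrightarrow> x ^ k \<in> rat_adjoin \<theta>"
  by (induction k) (auto intro: rat_adjoin_mult)

lemma rat_adjoin_rat_eval: "x \<in> rat_adjoin \<theta> \<Longrightarrow> rat_eval p x \<in> rat_adjoin \<theta>"
  by (induction p) (auto intro: rat_adjoin_add rat_adjoin_mult rat_adjoin_of_rat)

section \<open>Minimal polynomials over the rationals, up to a constant factor\<close>

definition rat_min_poly :: "rat poly \<Rightarrow> complex \<Rightarrow> bool" where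
  "rat_min_poly f \<theta> \<longleftrightarrow> f \<noteq> 0 \<and> rat_eval f \<theta> = 0 \<and> (\<forall>g. g \<noteq> 0 \<longrightarrow> rat_eval g \<theta> = 0 \<longrightarrow> degree f \<le> degree g)"

lemma rat_min_poly_exists:
  assumes "h \<noteq> 0" "rat_eval h \<theta> = 0"
  shows "\<exists>f. rat_min_poly f \<theta>"
  using ex_has_least_nat[of "\<lambda>g. g \<noteq> 0 \<and> rat_eval g \<theta> = 0" h degree] assms
  unfolding rat_min_poly_def by blast

lemma rat_min_poly_dvd:
  assumes f: "rat_min_poly f \<theta>" and g: "rat_eval g \<theta> = 0"
  shows "f dvd g"
proof -
  have "rat_eval (f * (g div f) + g mod f) \<theta> = 0" using g by simp
  hence "rat_eval (g mod f) \<theta> = 0" using f unfolding rat_min_poly_def rat_eval_simps by simp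
  moreover have "g mod f = 0 \<or> degree (g mod f) < degree f"
    using f degree_mod_less by (auto simp: rat_min_poly_def)
  ultimately have "g mod f = 0" using f unfolding rat_min_poly_def by (meson not_le)
  thus ?thesis by (simp add: mod_eq_0_iff_dvd)
qed

text \<open>Irreducibility in disguise: the minimal polynomial \<open>k\<close> of \<open>r\<close>
  divides \<open>f = k * l\<close>. If \<open>k\<close> did not vanish at \<open>\<theta>\<close>,
  then \<open>l\<close> would, and the least degree of \<open>f\<close> would make \<open>k\<close>
  constant.\<close>

lemma rat_min_poly_root:
  assumes f: "rat_min_poly f \<theta>" and r: "rat_eval f r = 0"
  shows "rat_min_poly f r"
proof -
  have f0: "f \<noteq> 0" using f by (simp add: rat_min_poly_def)
  obtain k where k: "rat_min_poly k r" using rat_min_poly_exists[OF f0 r] by blast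
  then obtain l where l: "f = k * l" using rat_min_poly_dvd[OF k r] by auto
  have kl: "k \<noteq> 0" "l \<noteq> 0" using f0 l by auto
  have "rat_eval k \<theta> = 0"
  proof (rule ccontr)
    assume "rat_eval k \<theta> \<noteq> 0"
    hence "rat_eval l \<theta> = 0" using f l by (auto simp: rat_min_poly_def)
    hence "degree f \<le> degree l" using f kl by (auto simp: rat_min_poly_def)
    hence "degree k = 0" using kl by (simp add: l degree_mult_eq)
    then obtain c where "k = [:c:]" by (rule degree_eq_zeroE)
    thus False using k by (simp add: rat_min_poly_def)
  qed
  hence "degree f \<le> degree k" using f kl by (auto simp: rat_min_poly_def)
  thus ?thesis using k f0 r unfolding rat_min_poly_def by (meson order_trans)
qed

text \<open>Separability: a double root would be a root of the derivative, which has smaller degree,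
  although \<open>f\<close> has least degree at each of its roots.\<close>

lemma rat_min_poly_card_roots:
  assumes f: "rat_min_poly f \<theta>"
  shows "card {r. rat_eval f r = 0} = degree f"
proof -
  let ?F = "map_poly of_rat f :: complex poly"
  have f0: "?F \<noteq> 0" using f by (simp add: rat_min_poly_def)
  have dpos: "degree f > 0"
  proof (rule ccontr)
    assume "\<not> degree f > 0"
    then obtain c where "f = [:c:]" by (auto elim: degree_eq_zeroE)
    thus False using f by (simp add: rat_min_poly_def)
  qed
  have "rsquarefree ?F"
    unfolding rsquarefree_roots
  proof (intro allI notI)
    fix r assume "poly ?F r = 0 \<and> poly (pderiv ?F) r = 0"
    hence r: "rat_eval f r = 0" "rat_eval (pderiv f) r = 0"
      by (simp_all add: of_rat_hom.map_poly_pderiv)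
    have "pderiv f \<noteq> 0" using dpos by (simp add: pderiv_eq_0_iff)
    hence "degree f \<le> degree (pderiv f)"
      using rat_min_poly_root[OF f r(1)] r(2) by (auto simp: rat_min_poly_def)
    thus False using dpos by (simp add: degree_pderiv)
  qed
  thus ?thesis using rsquarefree_card_degree[OF f0] by simp
qed

text \<open>The roots of \<open>h\<close> include all conjugates of \<open>\<theta>\<close>, so the
  last assumption makes \<open>K\<close> normal over the rationals and totally real. The polynomial
  \<open>h\<close> may be reducible; \<open>min_poly\<close> is extracted from it.\<close>

locale totally_real_galois =
  fixes K :: "complex set" and \<theta> :: complex and h :: "rat poly"
  assumes K: "K = rat_adjoin \<theta>"
    and h: "h \<noteq> 0" "rat_eval h \<theta> = 0"
    and roots: "\<And>r. rat_eval h r = 0 \<Longrightarrow> r \<in> K \<and> r \<in> \<real>"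
begin

abbreviation "E \<equiv> real_embeddings K"

lemmas K_of_rat = rat_adjoin_of_rat[of _ \<theta>, folded K]
  and K_add = rat_adjoin_add[of _ \<theta>, folded K]
  and K_mult = rat_adjoin_mult[of _ \<theta>, folded K]
  and K_uminus = rat_adjoin_uminus[of _ \<theta>, folded K]
  and K_diff = rat_adjoin_diff[of _ \<theta>, folded K]
  and K_prod = rat_adjoin_prod[where \<theta> = \<theta>, folded K]
  and K_rat_eval = rat_adjoin_rat_eval[of _ \<theta>, folded K]
  and K_0 [simp] = rat_adjoin_0[of \<theta>, folded K]
  and K_1 [simp] = rat_adjoin_1[of \<theta>, folded K]
  and K_\<theta> [simp] = rat_adjoin_generator[of \<theta>, folded K]

definition min_poly :: "rat poly" where "min_poly = (SOME g. rat_min_poly g \<theta>)"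

lemma rat_min_poly: "rat_min_poly min_poly \<theta>"
  unfolding min_poly_def using rat_min_poly_exists[OF h] by (rule someI_ex)

lemma root_min_poly: "rat_eval min_poly r = 0 \<Longrightarrow> r \<in> K \<and> r \<in> \<real>"
proof -
  assume "rat_eval min_poly r = 0"
  moreover obtain g where "h = min_poly * g" using rat_min_poly_dvd[OF rat_min_poly h(2)] by auto
  ultimately have "rat_eval h r = 0" by simp
  thus ?thesis by (rule roots)
qed

lemma K_real: "x \<in> K \<Longrightarrow> x \<in> \<real>"
proof -
  have \<theta>: "\<theta> \<in> \<real>" using roots[OF h(2)] by simp
  have "rat_eval p \<theta> \<in> \<real>" for p
    using \<theta> by (induction p) (auto simp: of_rat_complex)
  thus "x \<in> K \<Longrightarrow> x \<in> \<real>" by (auto simp: K rat_adjoin_def)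
qed

lemma embedding_add: "\<sigma> \<in> E \<Longrightarrow> x \<in> K \<Longrightarrow> y \<in> K \<Longrightarrow> \<sigma> (x + y) = \<sigma> x + \<sigma> y"
  and embedding_mult: "\<sigma> \<in> E \<Longrightarrow> x \<in> K \<Longrightarrow> y \<in> K \<Longrightarrow> \<sigma> (x * y) = \<sigma> x * \<sigma> y"
  and embedding_1 [simp]: "\<sigma> \<in> E \<Longrightarrow> \<sigma> 1 = 1"
  and embedding_outside: "\<sigma> \<in> E \<Longrightarrow> x \<notin> K \<Longrightarrow> \<sigma> x = 0"
  by (simp_all add: real_embeddings_def)

lemma embedding_0 [simp]: "\<sigma> \<in> E \<Longrightarrow> \<sigma> 0 = 0"
  using embedding_add[of \<sigma> 0 0] by simp

lemma embedding_uminus: "\<sigma> \<in> E \<Longrightarrow> x \<in> K \<Longrightarrow> \<sigma> (- x) = - \<sigma> x"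
  using embedding_add[of \<sigma> x "- x"] K_uminus[of x] by simp

lemma embedding_diff: "\<sigma> \<in> E \<Longrightarrow> x \<in> K \<Longrightarrow> y \<in> K \<Longrightarrow> \<sigma> (x - y) = \<sigma> x - \<sigma> y"
  using embedding_add[of \<sigma> x "- y"] K_uminus[of y] embedding_uminus[of \<sigma> y] by simp

lemma embedding_prod:
  assumes "\<sigma> \<in> E" "\<And>i. i \<in> A \<Longrightarrow> g i \<in> K"
  shows "\<sigma> (prod g A) = (\<Prod>i\<in>A. \<sigma> (g i))"
  using assms(2) by (induction A rule: infinite_finite_induct)
    (simp_all add: assms(1) embedding_mult K_prod)

lemma embedding_of_rat:
  assumes \<sigma>: "\<sigma> \<in> E"
  shows "\<sigma> (of_rat c) = of_rat c"
proof -
  have nat: "\<sigma> (of_nat m) = of_nat m" for m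
    using \<sigma> K_of_rat[of "of_nat _"] by (induction m) (simp_all add: embedding_add)
  have int: "\<sigma> (of_int m) = of_int m" for m
    using nat \<sigma> K_of_rat[of "of_nat _"] by (cases m rule: int_cases2) (simp_all add: embedding_uminus)
  obtain a b where c: "c = Rat.Fract a b" "b > 0" by (cases c) auto
  have "\<sigma> (of_rat c) * of_int b = \<sigma> (of_rat c * of_int b)"
    using embedding_mult[OF \<sigma> K_of_rat[of c] K_of_rat[of "of_int b"]] int by simp
  also have "of_rat c * of_int b = (of_int a :: complex)" using c by (simp add: of_rat_rat)
  also have "\<sigma> (of_int a) = of_rat c * of_int b" using c by (simp add: of_rat_rat int)
  finally have "\<sigma> (of_rat c) * of_int b = of_rat c * of_int b" .
  thus ?thesis using c(2) by simp
qed

lemma embedding_rat_eval: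
  assumes \<sigma>: "\<sigma> \<in> E" and x: "x \<in> K"
  shows "complex_of_real (\<sigma> (rat_eval p x)) = rat_eval p (complex_of_real (\<sigma> x))"
proof (induction p)
  case (pCons c p)
  have "\<sigma> (of_rat c + x * rat_eval p x) = of_rat c + \<sigma> x * \<sigma> (rat_eval p x)"
    using \<sigma> x by (simp add: embedding_add embedding_mult embedding_of_rat K_mult K_of_rat K_rat_eval)
  thus ?case using pCons by (simp flip: of_rat_complex)
qed (simp add: \<sigma>)

lemma embedding_root_min_poly: "\<sigma> \<in> E \<Longrightarrow> rat_eval min_poly (complex_of_real (\<sigma> \<theta>)) = 0"
  using embedding_rat_eval[of \<sigma> \<theta> min_poly] rat_min_poly by (simp add: rat_min_poly_def)

text \<open>Normality: \<open>\<sigma> \<theta>\<close> is a root of \<open>min_poly\<close> and so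
  lies in \<open>K\<close>. This is what lets embeddings be composed, so that \<open>E\<close> can
  act as the Galois group.\<close>

lemma embedding_in_K: "\<sigma> \<in> E \<Longrightarrow> complex_of_real (\<sigma> x) \<in> K"
proof (cases "x \<in> K")
  assume \<sigma>: "\<sigma> \<in> E"
  case True
  then obtain p where "x = rat_eval p \<theta>" by (auto simp: K rat_adjoin_def)
  thus ?thesis using embedding_rat_eval[OF \<sigma> K_\<theta>, of p] root_min_poly[OF embedding_root_min_poly[OF \<sigma>]] K_rat_eval by simp
qed (simp add: embedding_outside)

lemma embedding_eqI:
  assumes "\<sigma> \<in> E" "\<tau> \<in> E" "\<sigma> \<theta> = \<tau> \<theta>"
  shows "\<sigma> = \<tau>"
proof
  fix x show "\<sigma> x = \<tau> x"
  proof (cases "x \<in> K")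
    case True
    then obtain p where "x = rat_eval p \<theta>" by (auto simp: K rat_adjoin_def)
    thus ?thesis using embedding_rat_eval[OF assms(1) K_\<theta>, of p] embedding_rat_eval[OF assms(2) K_\<theta>, of p] assms(3)
      by (metis of_real_eq_iff)
  qed (simp add: embedding_outside[OF assms(1)] embedding_outside[OF assms(2)])
qed

lemma finite_embeddings: "finite E"
proof (rule inj_on_finite)
  show "inj_on (\<lambda>\<sigma>. complex_of_real (\<sigma> \<theta>)) E" by (auto intro!: inj_onI embedding_eqI)
  show "(\<lambda>\<sigma>. complex_of_real (\<sigma> \<theta>)) ` E \<subseteq> {r. rat_eval min_poly r = 0}" using embedding_root_min_poly by auto
  show "finite {r. rat_eval min_poly r = 0}" using rat_min_poly by (intro poly_roots_finite) (simp add: rat_min_poly_def)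
qed

text \<open>Sending \<open>\<theta>\<close> to \<open>r\<close> is well defined because
  \<open>min_poly\<close> divides the difference of two polynomials that agree at
  \<open>\<theta>\<close>, and it has real values because \<open>r\<close> is real.\<close>

lemma embedding_of_root:
  assumes r: "rat_eval min_poly r = 0"
  obtains \<sigma> where "\<sigma> \<in> E" "\<And>p. complex_of_real (\<sigma> (rat_eval p \<theta>)) = rat_eval p r"
proof -
  have r_real: "r \<in> \<real>" using root_min_poly[OF r] by simp
  have eval_real: "rat_eval p r \<in> \<real>" for p
    using r_real by (induction p) (auto simp: of_rat_complex)
  have cong: "rat_eval p r = rat_eval q r" if "rat_eval p \<theta> = rat_eval q \<theta>" for p q
  proof -
    have "min_poly dvd p - q" using that by (intro rat_min_poly_dvd[OF rat_min_poly]) simp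
    then obtain g where "p - q = min_poly * g" by auto
    hence "rat_eval (p - q) r = 0" using r by simp
    thus ?thesis by simp
  qed
  \<comment> \<open>\<open>SOME\<close> picks a polynomial that represents \<open>x\<close>; the
    value 0 outside \<open>K\<close> is the one that \<open>real_embeddings\<close>
    prescribes.\<close>
  define \<sigma> where "\<sigma> = (\<lambda>x. if x \<in> K then Re (rat_eval (SOME p. x = rat_eval p \<theta>) r) else 0)"
  have \<sigma>: "\<sigma> (rat_eval p \<theta>) = Re (rat_eval p r)" for p
  proof -
    have "rat_eval p \<theta> = rat_eval (SOME q. rat_eval p \<theta> = rat_eval q \<theta>) \<theta>"
      by (rule someI) (rule refl)
    from cong[OF this] show ?thesis by (simp add: \<sigma>_def K_rat_eval)
  qed
  have \<sigma>c: "complex_of_real (\<sigma> (rat_eval p \<theta>)) = rat_eval p r" for p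
    using eval_real[of p] by (simp add: \<sigma>)
  have "\<sigma> \<in> E"
    unfolding real_embeddings_def
  proof (intro CollectI conjI ballI allI impI)
    fix x y assume "x \<in> K" "y \<in> K"
    then obtain p q where x: "x = rat_eval p \<theta>" and y: "y = rat_eval q \<theta>" by (auto simp: K rat_adjoin_def)
    have "complex_of_real (\<sigma> (x + y)) = complex_of_real (\<sigma> x + \<sigma> y)"
      using \<sigma>c[of "p + q"] \<sigma>c[of p] \<sigma>c[of q] by (simp add: x y)
    thus "\<sigma> (x + y) = \<sigma> x + \<sigma> y" by (simp only: of_real_eq_iff)
    have "complex_of_real (\<sigma> (x * y)) = complex_of_real (\<sigma> x * \<sigma> y)"
      using \<sigma>c[of "p * q"] \<sigma>c[of p] \<sigma>c[of q] by (simp add: x y)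
    thus "\<sigma> (x * y) = \<sigma> x * \<sigma> y" by (simp only: of_real_eq_iff)
  next
    show "\<sigma> 1 = 1" using \<sigma>[of "[:1:]"] by simp
  qed (simp add: \<sigma>_def)
  thus ?thesis using \<sigma>c by (rule that)
qed

text \<open>The root \<open>\<theta>\<close> itself yields the inclusion of \<open>K\<close>. It
  supplies the factor \<open>x\<close> of the norm in \<open>K_inverse\<close> and the embedding
  that preserves the sign of every square root in \<open>deficiency_ge\<close>.\<close>

lemma id_embedding: "(\<lambda>x. if x \<in> K then Re x else 0) \<in> E"
proof -
  obtain \<sigma> where \<sigma>: "\<sigma> \<in> E" "\<And>p. complex_of_real (\<sigma> (rat_eval p \<theta>)) = rat_eval p \<theta>"
    using embedding_of_root[of \<theta>] rat_min_poly unfolding rat_min_poly_def by metis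
  have "(\<lambda>x. if x \<in> K then Re x else 0) = \<sigma>"
  proof
    fix x show "(if x \<in> K then Re x else 0) = \<sigma> x"
    proof (cases "x \<in> K")
      case True
      then obtain p where "x = rat_eval p \<theta>" by (auto simp: K rat_adjoin_def)
      with \<sigma>(2)[of p] True show ?thesis by (metis Re_complex_of_real)
    qed (simp add: embedding_outside[OF \<sigma>(1)])
  qed
  with \<sigma>(1) show ?thesis by simp
qed

lemma comp_embedding:
  assumes "\<tau> \<in> E" "\<sigma> \<in> E"
  shows "(\<lambda>x. \<tau> (complex_of_real (\<sigma> x))) \<in> E"
  unfolding real_embeddings_def using assms embedding_in_K
  by (auto simp: embedding_add embedding_mult embedding_outside)

text \<open>Inverses in \<open>K\<close> are not at hand here, so injectivity comes from minimality
  instead: \<open>min_poly\<close> is also minimal for \<open>\<sigma> \<theta>\<close>, hence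
  divides any \<open>p\<close> that vanishes there.\<close>

lemma embedding_eq_0_iff:
  assumes "\<sigma> \<in> E" "x \<in> K"
  shows "\<sigma> x = 0 \<longleftrightarrow> x = 0"
proof
  assume 0: "\<sigma> x = 0"
  obtain p where p: "x = rat_eval p \<theta>" using assms(2) by (auto simp: K rat_adjoin_def)
  have "rat_eval p (complex_of_real (\<sigma> \<theta>)) = 0"
    using embedding_rat_eval[OF assms(1) K_\<theta>, of p] 0 p by simp
  hence "min_poly dvd p" by (rule rat_min_poly_dvd[OF rat_min_poly_root[OF rat_min_poly embedding_root_min_poly[OF assms(1)]]])
  thus "x = 0" using rat_min_poly by (auto simp: p rat_min_poly_def)
qed (simp add: assms(1))

lemma embedding_inj:
  assumes "\<sigma> \<in> E" "x \<in> K" "y \<in> K" "\<sigma> x = \<sigma> y"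
  shows "x = y"
  using embedding_eq_0_iff[OF assms(1) K_diff[OF assms(2,3)]] embedding_diff[OF assms(1-3)] assms(4) by simp

text \<open>Translation by \<open>\<tau>\<close> in the Galois group: an injective map of the finite
  set \<open>E\<close> to itself. It reindexes the products that define norms.\<close>

lemma bij_comp_embedding:
  assumes \<tau>: "\<tau> \<in> E"
  shows "bij_betw (\<lambda>\<sigma> x. \<tau> (complex_of_real (\<sigma> x))) E E"
proof -
  have "inj_on (\<lambda>\<sigma> x. \<tau> (complex_of_real (\<sigma> x))) E"
  proof (rule inj_onI, rule ext)
    fix \<sigma> \<rho> x assume "\<sigma> \<in> E" "\<rho> \<in> E" "(\<lambda>x. \<tau> (complex_of_real (\<sigma> x))) = (\<lambda>x. \<tau> (complex_of_real (\<rho> x)))"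
    thus "\<sigma> x = \<rho> x"
      using embedding_inj[OF \<tau>, of "complex_of_real (\<sigma> x)" "complex_of_real (\<rho> x)"] embedding_in_K
      by (metis of_real_eq_iff)
  qed
  moreover have "(\<lambda>\<sigma> x. \<tau> (complex_of_real (\<sigma> x))) ` E \<subseteq> E" using comp_embedding[OF \<tau>] by blast
  ultimately show ?thesis using endo_inj_surj[OF finite_embeddings] by (auto simp: bij_betw_def)
qed

text \<open>If \<open>g(\<theta>)\<close> with \<open>g\<close> of smaller degree than the minimal polynomial has all conjugates equal to \<open>y\<close>,
  then \<open>g - y\<close> has too many roots.\<close>
lemma embedding_fixed_imp_rational:
  assumes y: "complex_of_real y \<in> K" "\<And>\<sigma>. \<sigma> \<in> E \<Longrightarrow> \<sigma> (complex_of_real y) = y"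
  shows "y \<in> \<rat>"
proof -
  obtain p where p: "complex_of_real y = rat_eval p \<theta>" using y(1) by (auto simp: K rat_adjoin_def)
  define g where "g = p mod min_poly"
  have "rat_eval (min_poly * (p div min_poly) + g) \<theta> = complex_of_real y" by (simp add: g_def p)
  hence g: "rat_eval g \<theta> = complex_of_real y" using rat_min_poly unfolding rat_eval_simps rat_min_poly_def by simp
  have deg: "g = 0 \<or> degree g < degree min_poly"
    using rat_min_poly degree_mod_less unfolding g_def by (auto simp: rat_min_poly_def)
  define G where "G = map_poly of_rat g - [:complex_of_real y:]"
  have "G = 0"
  proof (rule ccontr)
    assume "G \<noteq> 0"
    have "{r. rat_eval min_poly r = 0} \<subseteq> {r. poly G r = 0}"
    proof
      fix r assume "r \<in> {r. rat_eval min_poly r = 0}"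
      then obtain \<sigma> where \<sigma>: "\<sigma> \<in> E" "\<And>p. complex_of_real (\<sigma> (rat_eval p \<theta>)) = rat_eval p r"
        using embedding_of_root[of r] by blast
      have "rat_eval g r = complex_of_real y" using \<sigma>(2)[of g] y(2)[OF \<sigma>(1)] by (simp add: g)
      thus "r \<in> {r. poly G r = 0}" by (simp add: G_def)
    qed
    hence "degree min_poly \<le> card {r. poly G r = 0}"
      using rat_min_poly_card_roots[OF rat_min_poly] card_mono[OF poly_roots_finite[OF \<open>G \<noteq> 0\<close>]] by metis
    also have "\<dots> \<le> degree G" using \<open>G \<noteq> 0\<close> by (rule card_poly_roots_bound)
    also have "\<dots> \<le> degree g" unfolding G_def by (rule degree_diff_le) simp_all
    finally have "degree min_poly = 0" using deg by auto
    then obtain c where "min_poly = [:c:]" by (rule degree_eq_zeroE)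
    thus False using rat_min_poly by (simp add: rat_min_poly_def)
  qed
  hence "Polynomial.coeff (map_poly of_rat g) 0 = complex_of_real y" by (simp add: G_def)
  hence "complex_of_real y = complex_of_real (of_rat (Polynomial.coeff g 0))" by (simp add: coeff_map_poly of_rat_complex)
  thus ?thesis by (simp only: of_real_eq_iff) simp
qed

end

section \<open>Arithmetic of the real quadratic fields\<close>

text \<open>Here -1 is not a square modulo \<open>q\<close>: raising
  \<open>a ^ 2 = - (z ^ 2)\<close> to the odd power \<open>k = (p - 1) div 2\<close> and applying
  Fermat's theorem to both sides would give 1 = -1 modulo \<open>q\<close>.\<close>

lemma prime_3_mod_4_dvd_sum_squares:
  fixes q a z :: int
  assumes "prime q" "[q = 3] (mod 4)" "q dvd a ^ 2 + z ^ 2"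
  shows "q dvd a \<and> q dvd z"
proof -
  define p where "p = nat q"
  have qp: "q = int p" using prime_ge_0_int[OF assms(1)] by (simp add: p_def)
  have q: "q = int p" "prime p" using assms(1) qp by simp_all
  have "q mod 4 = 3" using assms(2) by (simp add: cong_def)
  hence p4: "p mod 4 = 3" unfolding q(1) by presburger
  define k where "k = (p - 1) div 2"
  have k: "odd k" "p - 1 = 2 * k" using p4 unfolding k_def by presburger+
  have fermat: "[w ^ (p - 1) = 1] (mod q)" if "\<not> q dvd w" for w
  proof -
    have "[nat \<bar>w\<bar> ^ (p - 1) = 1] (mod p)" using that q(2) by (intro fermat_theorem) (simp_all add: q(1) dvd_nat_abs_iff)
    hence "[int (nat \<bar>w\<bar> ^ (p - 1)) = int 1] (mod int p)" by (simp only: cong_int_iff)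
    moreover have "int (nat \<bar>w\<bar> ^ (p - 1)) = w ^ (p - 1)" using k(2) by (simp add: power_even_abs)
    ultimately show ?thesis by (simp only: of_nat_1 q(1))
  qed
  have az: "q dvd a \<longleftrightarrow> q dvd z"
    using assms(1,3) dvd_add_right_iff[of q "a ^ 2" "z ^ 2"] dvd_add_left_iff[of q "z ^ 2" "a ^ 2"]
    by (auto simp: prime_dvd_power_iff)
  show ?thesis
  proof (rule ccontr)
    assume "\<not> (q dvd a \<and> q dvd z)"
    with az have nd: "\<not> q dvd a" "\<not> q dvd z" by auto
    have "[a ^ 2 = - (z ^ 2)] (mod q)" using assms(3) by (simp add: cong_iff_dvd_diff)
    hence "[(a ^ 2) ^ k = (- (z ^ 2)) ^ k] (mod q)" by (rule cong_pow)
    hence "[a ^ (p - 1) = - (z ^ (p - 1))] (mod q)" using k by (simp add: power_mult)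
    moreover have "[- (z ^ (p - 1)) = - 1] (mod q)" using fermat[OF nd(2)] by (simp add: cong_minus_minus_iff)
    ultimately have "[1 = - 1] (mod q)" using fermat[OF nd(1)] by (meson cong_sym cong_trans)
    hence "q dvd 2" by (simp add: cong_iff_dvd_diff)
    hence "q \<le> 2" by (rule zdvd_imp_le) simp
    thus False using p4 q prime_ge_2_nat[OF q(2)] by auto
  qed
qed

text \<open>The descent: modulo \<open>q\<close> both \<open>- c\<close> and \<open>- c * d\<close> are non-residues.\<close>
lemma descent_no_solution:
  fixes q d e c rd rc :: int
  assumes q: "prime q" "[q = 3] (mod 4)"
    and d: "\<not> q dvd d" "[rd ^ 2 = d] (mod q)" and c: "\<not> q dvd c" "[rc ^ 2 = c] (mod q)"
    and e: "q dvd e" "\<not> q ^ 2 dvd e"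
    and eq: "x1 ^ 2 + d * x2 ^ 2 - e * (y1 ^ 2 + d * y2 ^ 2) = - c * z ^ 2" "x1 * x2 = e * (y1 * y2)"
  shows "z = 0"
proof (rule ccontr)
  assume "z \<noteq> 0"
  with eq show False
  \<comment> \<open>Infinite descent on the size of \<open>z\<close>. The equations are the two
    coordinates of \<open>x^2 - e y^2 = - c z^2\<close> with \<open>x = x1 + x2 sqrt d\<close> and
    \<open>y = y1 + y2 sqrt d\<close>; all five integers turn out to be divisible by
    \<open>q\<close>, and dividing them by \<open>q\<close> gives a smaller solution.\<close>
  proof (induction "nat \<bar>z\<bar>" arbitrary: x1 x2 y1 y2 z rule: less_induct)
    case less
    have rd: "\<not> q dvd rd" using d cong_dvd_iff[OF d(2)] q(1) by (simp add: prime_dvd_power_iff)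
    have rc: "\<not> q dvd rc" using c cong_dvd_iff[OF c(2)] q(1) by (simp add: prime_dvd_power_iff)
    have e2: "q dvd w" if "q ^ 2 dvd e * w" for w
    proof -
      obtain e' where e': "e = q * e'" using e(1) by auto
      have "\<not> q dvd e'" using e(2) e' by (auto simp: power2_eq_square)
      moreover have "q dvd e' * w" using that q(1) e' by (auto simp: power2_eq_square)
      ultimately show ?thesis using q(1) by (simp add: prime_dvd_mult_iff)
    qed
    have "q dvd x1 * x2" using less(3) e(1) by simp
    hence "q dvd x1 \<or> q dvd x2" using q(1) by (simp add: prime_dvd_mult_iff)
    moreover have main: "q dvd x1 ^ 2 + d * x2 ^ 2 + c * z ^ 2"
    proof -
      have "x1 ^ 2 + d * x2 ^ 2 + c * z ^ 2 = e * (y1 ^ 2 + d * y2 ^ 2)" using less(2) by simp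
      thus ?thesis using e(1) by simp
    qed
    \<comment> \<open>Modulo \<open>q\<close> the coefficients become squares. As \<open>q\<close>
      divides \<open>x1\<close> or \<open>x2\<close>, a sum of only two squares remains, and
      \<open>q\<close> must divide both of their bases.\<close>
    have main2: "q dvd x1 ^ 2 + (rd * x2) ^ 2 + (rc * z) ^ 2"
    proof -
      have "[x1 ^ 2 + rd ^ 2 * x2 ^ 2 + rc ^ 2 * z ^ 2 = x1 ^ 2 + d * x2 ^ 2 + c * z ^ 2] (mod q)"
        using d(2) c(2) by (intro cong_add cong_mult cong_refl)
      thus ?thesis using main by (simp add: power_mult_distrib cong_dvd_iff)
    qed
    ultimately have x: "q dvd x1" "q dvd x2" and z: "q dvd z"
    proof -
      have "q dvd x1 \<and> q dvd x2 \<and> q dvd z"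
      proof (cases "q dvd x1")
        case True
        hence "q dvd x1 ^ 2" by (simp add: power2_eq_square)
        hence "q dvd (rd * x2) ^ 2 + (rc * z) ^ 2" 
          using main2 by (metis add.assoc dvd_add_right_iff)
        from prime_3_mod_4_dvd_sum_squares[OF q this] show ?thesis 
          using True rd rc q(1) by (simp add: prime_dvd_mult_iff)
      next
        case False
        with \<open>q dvd x1 \<or> q dvd x2\<close> have x2: "q dvd x2" by simp
        hence "q dvd (rd * x2) ^ 2" by (simp add: power2_eq_square)
        hence "q dvd x1 ^ 2 + (rc * z) ^ 2" 
          using main2 by (metis add.assoc add.commute dvd_add_right_iff)
        from prime_3_mod_4_dvd_sum_squares[OF q this] show ?thesis 
          using x2 rd rc q(1) by (simp add: prime_dvd_mult_iff)
      qed
      thus "q dvd x1" "q dvd x2" "q dvd z" by auto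
    qed
    then obtain x1' x2' z' where x': "x1 = q * x1'" "x2 = q * x2'" "z = q * z'" by (auto elim!: dvdE)
    have "e * (y1 * y2) = q ^ 2 * (x1' * x2')" using less(3) by (simp add: x' power2_eq_square mult_ac)
    hence "q ^ 2 dvd e * (y1 * y2)" by simp
    hence "q dvd y1 \<or> q dvd y2" using e2 q(1) prime_dvd_mult_iff by blast
    moreover have "q ^ 2 dvd e * (y1 ^ 2 + d * y2 ^ 2)"
    proof -
      have "e * (y1 ^ 2 + d * y2 ^ 2) = q ^ 2 * (x1' ^ 2 + d * x2' ^ 2 + c * z' ^ 2)"
        using less(2) by (simp add: x' algebra_simps)
      thus ?thesis by simp
    qed
    hence "q dvd y1 ^ 2 + d * y2 ^ 2" by (rule e2)
    \<comment> \<open>One of \<open>y1\<close>, \<open>y2\<close> is divisible by \<open>q\<close>,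
      and the quadratic relation with \<open>d\<close> prime to \<open>q\<close> passes this on to
      the other.\<close>
    ultimately have "q dvd y1 \<and> q dvd y2"
      using q(1) d(1) dvd_add_right_iff[of q "y1 ^ 2" "d * y2 ^ 2"] dvd_add_left_iff[of q "d * y2 ^ 2" "y1 ^ 2"]
      by (auto simp: prime_dvd_mult_iff prime_dvd_power_iff)
    then obtain y1' y2' where y': "y1 = q * y1'" "y2 = q * y2'" by (auto elim!: dvdE)
    have q0: "q ^ 2 \<noteq> 0" "q > 1" using q(1) by (auto simp: prime_gt_1_int prime_ge_0_int)
    have "q ^ 2 * (x1' ^ 2 + d * x2' ^ 2 - e * (y1' ^ 2 + d * y2' ^ 2)) = q ^ 2 * (- c * z' ^ 2)"
      using less(2) by (simp add: x' y' algebra_simps)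
    hence eq1: "x1' ^ 2 + d * x2' ^ 2 - e * (y1' ^ 2 + d * y2' ^ 2) = - c * z' ^ 2"
      using mult_left_cancel[OF q0(1)] by blast
    have "q ^ 2 * (x1' * x2') = q ^ 2 * (e * (y1' * y2'))"
      using less(3) by (simp add: x' y' power2_eq_square algebra_simps)
    hence eq2: "x1' * x2' = e * (y1' * y2')" using mult_left_cancel[OF q0(1)] by blast
    have "z' \<noteq> 0" using less(4) x' by auto
    moreover from this have "nat \<bar>z'\<bar> < nat \<bar>z\<bar>" using q0 by (simp add: x' abs_mult)
    ultimately show False using less(1) eq1 eq2 by blast
  qed
qed

section \<open>Square classes in equations of Pell type\<close>

lemma coprime_mult_eq_square_times:
  fixes a b p y :: nat
  assumes "prime p" "coprime a b" "a * b = p * r * y ^ 2"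
  shows "\<exists>a' b'. coprime a' b' \<and> a' * b' = r * y ^ 2 \<and> (a = a' \<or> a = p * a')"
proof -
  have "p dvd a * b" using assms by simp
  then consider "p dvd a" | "p dvd b" using assms(1) by (auto simp: prime_dvd_mult_iff)
  thus ?thesis
  proof cases
    case 1
    then obtain a' where a': "a = p * a'" by auto
    have "a' * b = r * y ^ 2" using assms a' by (simp add: prime_gt_0_nat)
    moreover have "coprime a' b" using assms(2) a' by simp
    ultimately show ?thesis using a' by blast
  next
    case 2
    then obtain b' where b': "b = p * b'" by auto
    have "a * b' = r * y ^ 2" using assms b' by (simp add: prime_gt_0_nat)
    moreover have "coprime a b'" using assms(2) b' by simp
    ultimately show ?thesis by blast
  qed
qed

text \<open>Stripping \<open>p\<close> and then \<open>r\<close> from whichever factor each divides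
  leaves coprime factors whose product is a square, so each of these is a square.\<close>

lemma coprime_mult_eq_two_primes_square:
  fixes a b p r y :: nat
  assumes "prime p" "prime r" "coprime a b" "a * b = p * r * y ^ 2" "a > 0" "b > 0"
  shows "\<exists>c\<in>{1, p, r, p * r}. \<exists>s. a = c * s ^ 2"
proof -
  obtain a' b' where 1: "coprime a' b'" "a' * b' = r * y ^ 2" "a = a' \<or> a = p * a'"
    using coprime_mult_eq_square_times[OF assms(1,3,4)] by blast
  from 1(2) have "a' * b' = r * 1 * y ^ 2" by simp
  then obtain a'' b'' where 2: "coprime a'' b''" "a'' * b'' = 1 * y ^ 2" "a' = a'' \<or> a' = r * a''"
    using coprime_mult_eq_square_times[OF assms(2) 1(1)] by blast
  have "p * r * y ^ 2 > 0" unfolding assms(4)[symmetric] using assms(5,6) by simp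
  hence "y ^ 2 > 0" by simp
  hence "a'' * b'' > 0" using 2(2) by simp
  hence "a'' > 0" "b'' > 0" by simp_all
  hence "is_nth_power 2 a''"
    using is_nth_power_mult_coprime_natD(1)[OF 2(1)] 2(2) by (auto simp: is_nth_power_def)
  then obtain s where "a'' = s ^ 2" by (auto simp: is_nth_power_def)
  with 1(3) 2(3) show ?thesis by auto
qed

text \<open>Only the prime 2 can divide both \<open>A\<close> and \<open>A + 4\<close>. For odd
  \<open>A\<close> they are coprime. For \<open>A = 2 * B\<close> an odd \<open>B\<close> is
  excluded modulo 4, since \<open>B * (B + 2)\<close> would be 3 and \<open>p * r * z ^ 2\<close>
  would be 1; so \<open>A = 4 * C\<close>, with \<open>C\<close> and \<open>C + 1\<close>
  coprime.\<close>

lemma pell_square_class: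
  fixes A y p r :: nat
  assumes pr: "prime p" "prime r" "[p * r = 1] (mod 4)" and eq: "A * (A + 4) = p * r * y ^ 2"
    and A: "A > 0"
  shows "\<exists>c\<in>{1, p, r, p * r}. \<exists>s. A = c * s ^ 2"
proof (cases "odd A")
  case True
  have "coprime A (A + 4)"
  proof -
    have "coprime A (2 ^ 2)" using True by (subst coprime_power_right_iff) simp
    thus ?thesis unfolding coprime_iff_gcd_eq_1 by simp
  qed
  thus ?thesis using coprime_mult_eq_two_primes_square[OF pr(1,2) _ eq] A by simp
next
  case False
  then obtain B where B: "A = 2 * B" by auto
  have oddpr: "odd (p * r)"
  proof -
    have odd: "odd m" if "m mod 4 = 1" for m :: nat using that by presburger
    show ?thesis by (rule odd) (use pr(3) in \<open>simp add: cong_def\<close>)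
  qed
  have "even (p * r * y ^ 2)" unfolding eq[symmetric] B by simp
  hence "even y" using oddpr by simp
  then obtain z where z: "y = 2 * z" by auto
  have "4 * (B * (B + 2)) = 4 * (p * r * z ^ 2)"
    using eq by (simp add: B z power2_eq_square algebra_simps)
  hence eq2: "B * (B + 2) = p * r * z ^ 2" by linarith
  have "even B"
  proof (rule ccontr)
    assume "odd B"
    hence oz: "odd (p * r * z ^ 2)" by (simp flip: eq2)
    hence "odd z" by simp
    then obtain w where w: "z = 2 * w + 1" by (auto elim: oddE)
    obtain C where C: "B = 2 * C + 1" using \<open>odd B\<close> by (auto elim: oddE)
    have "[p * r * z ^ 2 = 1 * 1] (mod 4)"
    proof (rule cong_mult[OF pr(3)])
      have "z ^ 2 = 4 * (w ^ 2 + w) + 1" by (simp add: w power2_eq_square algebra_simps)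
      thus "[z ^ 2 = 1] (mod 4)" by (simp add: cong_def)
    qed
    moreover have "B * (B + 2) = 3 + (C ^ 2 + 2 * C) * 4" by (simp add: C power2_eq_square algebra_simps)
    hence "[B * (B + 2) = 3] (mod 4)" unfolding cong_def by (simp only: mod_mult_self1)
    ultimately show False unfolding eq2 by (simp add: cong_def)
  qed
  then obtain C where C: "B = 2 * C" by auto
  have "even (p * r * z ^ 2)" unfolding eq2[symmetric] C by simp
  hence "even z" using oddpr by simp
  then obtain w where w: "z = 2 * w" by auto
  have "4 * (C * (C + 1)) = 4 * (p * r * w ^ 2)"
    using eq2 by (simp add: C w power2_eq_square algebra_simps)
  hence "C * (C + 1) = p * r * w ^ 2" by linarith
  moreover have "coprime C (C + 1)" "C > 0" using A B C by simp_all
  ultimately obtain c s where "c \<in> {1, p, r, p * r}" "C = c * s ^ 2"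
    using coprime_mult_eq_two_primes_square[OF pr(1,2), of C "C + 1" w] by (metis add_gr_0)
  moreover from this(2) have "A = c * (2 * s) ^ 2" by (simp add: B C power2_eq_square)
  ultimately show ?thesis by blast
qed

section \<open>Rational solutions, and twisting them by an element of a quadratic field\<close>

lemma Rats_common_denominator:
  fixes x y z w :: real
  assumes "x \<in> \<rat>" "y \<in> \<rat>" "z \<in> \<rat>" "w \<in> \<rat>"
  obtains n :: int where "n \<noteq> 0" "x * of_int n \<in> \<int>" "y * of_int n \<in> \<int>" "z * of_int n \<in> \<int>" "w * of_int n \<in> \<int>"
proof -
  have den: "\<exists>n. n \<noteq> (0 :: int) \<and> v * of_int n \<in> \<int>" if "v \<in> \<rat>" for v :: real
    using that
  proof (cases v rule: Rats_cases')
    case (1 a b)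
    thus ?thesis by (intro exI[of _ b]) simp
  qed
  obtain k :: int where k: "k \<noteq> 0" "x * of_int k \<in> \<int>" using den[OF assms(1)] by (elim exE conjE)
  obtain l :: int where l: "l \<noteq> 0" "y * of_int l \<in> \<int>" using den[OF assms(2)] by (elim exE conjE)
  obtain m :: int where m: "m \<noteq> 0" "z * of_int m \<in> \<int>" using den[OF assms(3)] by (elim exE conjE)
  obtain n :: int where n: "n \<noteq> 0" "w * of_int n \<in> \<int>" using den[OF assms(4)] by (elim exE conjE)
  have "x * of_int (k * l * m * n) = (x * of_int k) * of_int (l * m * n)"
    "y * of_int (k * l * m * n) = (y * of_int l) * of_int (k * m * n)"
    "z * of_int (k * l * m * n) = (z * of_int m) * of_int (k * l * n)"
    "w * of_int (k * l * m * n) = (w * of_int n) * of_int (k * l * m)" by simp_all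
  with k l m n show ?thesis
    by (intro that[of "k * l * m * n"]) (simp_all only: Ints_mult Ints_of_int mult_eq_0_iff simp_thms)
qed

text \<open>Clearing denominators turns the common denominator \<open>n\<close> into the
  \<open>z\<close> of the integral descent, which would force \<open>n = 0\<close>.\<close>

lemma descent_no_rational_solution:
  fixes q d e c rd rc :: int and x1 x2 y1 y2 :: real
  assumes q: "prime q" "[q = 3] (mod 4)"
    and d: "\<not> q dvd d" "[rd ^ 2 = d] (mod q)" and c: "\<not> q dvd c" "[rc ^ 2 = c] (mod q)"
    and e: "q dvd e" "\<not> q ^ 2 dvd e"
    and rat: "x1 \<in> \<rat>" "x2 \<in> \<rat>" "y1 \<in> \<rat>" "y2 \<in> \<rat>"
    and eq: "x1 ^ 2 + d * x2 ^ 2 - e * (y1 ^ 2 + d * y2 ^ 2) = - c" "x1 * x2 = e * (y1 * y2)"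
  shows False
proof -
  obtain n :: int where n: "n \<noteq> 0" "x1 * of_int n \<in> \<int>" "x2 * of_int n \<in> \<int>" "y1 * of_int n \<in> \<int>" "y2 * of_int n \<in> \<int>"
    by (rule Rats_common_denominator[OF rat])
  obtain a1 a2 b1 b2 :: int where ab: "x1 * n = a1" "x2 * n = a2" "y1 * n = b1" "y2 * n = b2"
    using n(2-5)[THEN Ints_cases] by metis
  have "real_of_int (a1 ^ 2 + d * a2 ^ 2 - e * (b1 ^ 2 + d * b2 ^ 2))
      = (x1 * n) ^ 2 + d * (x2 * n) ^ 2 - e * ((y1 * n) ^ 2 + d * (y2 * n) ^ 2)"
    by (simp add: ab)
  also have "\<dots> = (x1 ^ 2 + d * x2 ^ 2 - e * (y1 ^ 2 + d * y2 ^ 2)) * n ^ 2"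
    by (simp add: power_mult_distrib algebra_simps)
  also have "\<dots> = real_of_int (- c * n ^ 2)" by (simp add: eq(1))
  finally have 1: "a1 ^ 2 + d * a2 ^ 2 - e * (b1 ^ 2 + d * b2 ^ 2) = - c * n ^ 2"
    by (simp only: of_int_eq_iff)
  have "real_of_int (a1 * a2) = (x1 * n) * (x2 * n)" by (simp add: ab)
  also have "\<dots> = (x1 * x2) * n ^ 2" by (simp add: power2_eq_square)
  also have "\<dots> = e * ((y1 * n) * (y2 * n))" by (simp add: eq(2) power2_eq_square)
  also have "\<dots> = real_of_int (e * (b1 * b2))" by (simp add: ab)
  finally have 2: "a1 * a2 = e * (b1 * b2)" by (simp only: of_int_eq_iff)
  show False using descent_no_solution[OF q d c e 1 2] n(1) by contradiction
qed

lemma rational_square_int: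
  fixes x :: real
  assumes "x \<in> \<rat>" "x ^ 2 = of_int m"
  obtains k :: int where "x = of_int k" "k ^ 2 = m"
proof -
  have "algebraic_int (sqrt (of_int m))" by (intro algebraic_int_sqrt int_imp_algebraic_int) simp
  moreover have "\<bar>x\<bar> = sqrt (of_int m)" using assms(2) by (metis real_sqrt_abs)
  ultimately have "x \<in> \<int>" using assms(1) rational_algebraic_int_is_int[of x] algebraic_int_abs_real[of x] by simp
  then obtain k where k: "x = of_int k" by (rule Ints_cases)
  with assms(2) have "k ^ 2 = m" by (metis of_int_eq_iff of_int_power)
  with k show ?thesis by (rule that)
qed

text \<open>Multiplying \<open>x1 + x2 sqrt d\<close> and \<open>y1 + y2 sqrt d\<close> by
  \<open>(\<alpha> - b sqrt d) / s\<close> multiplies \<open>P + 2 Q sqrt d\<close>, the value of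
  the form \<open>x^2 - e y^2\<close>, by the square of that factor. The two identities compare the
  coefficients of 1 and of \<open>2 sqrt d\<close>.\<close>

lemma quadratic_twist:
  fixes \<alpha> b d e s x1 x2 y1 y2 :: real
  defines "P \<equiv> x1 ^ 2 + d * x2 ^ 2 - e * (y1 ^ 2 + d * y2 ^ 2)" and "Q \<equiv> x1 * x2 - e * (y1 * y2)"
  shows "((\<alpha> * x1 - b * d * x2) / s) ^ 2 + d * ((\<alpha> * x2 - b * x1) / s) ^ 2
      - e * (((\<alpha> * y1 - b * d * y2) / s) ^ 2 + d * ((\<alpha> * y2 - b * y1) / s) ^ 2)
      = ((\<alpha> ^ 2 + d * b ^ 2) * P - 4 * \<alpha> * (d * b) * Q) / s ^ 2"
    and "((\<alpha> * x1 - b * d * x2) / s) * ((\<alpha> * x2 - b * x1) / s)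
      - e * (((\<alpha> * y1 - b * d * y2) / s) * ((\<alpha> * y2 - b * y1) / s))
      = ((\<alpha> ^ 2 + d * b ^ 2) * Q - \<alpha> * b * P) / s ^ 2"
proof -
  have "(\<alpha> * x1 - b * d * x2) ^ 2 + d * (\<alpha> * x2 - b * x1) ^ 2
      - e * ((\<alpha> * y1 - b * d * y2) ^ 2 + d * (\<alpha> * y2 - b * y1) ^ 2)
      = (\<alpha> ^ 2 + d * b ^ 2) * P - 4 * \<alpha> * (d * b) * Q"
    unfolding P_def Q_def by (simp add: power2_eq_square algebra_simps)
  thus "((\<alpha> * x1 - b * d * x2) / s) ^ 2 + d * ((\<alpha> * x2 - b * x1) / s) ^ 2
      - e * (((\<alpha> * y1 - b * d * y2) / s) ^ 2 + d * ((\<alpha> * y2 - b * y1) / s) ^ 2)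
      = ((\<alpha> ^ 2 + d * b ^ 2) * P - 4 * \<alpha> * (d * b) * Q) / s ^ 2"
    by (simp add: power_divide flip: add_divide_distrib diff_divide_distrib)
  have "(\<alpha> * x1 - b * d * x2) * (\<alpha> * x2 - b * x1) - e * ((\<alpha> * y1 - b * d * y2) * (\<alpha> * y2 - b * y1))
      = (\<alpha> ^ 2 + d * b ^ 2) * Q - \<alpha> * b * P"
    unfolding P_def Q_def by (simp add: power2_eq_square algebra_simps)
  thus "((\<alpha> * x1 - b * d * x2) / s) * ((\<alpha> * x2 - b * x1) / s)
      - e * (((\<alpha> * y1 - b * d * y2) / s) * ((\<alpha> * y2 - b * y1) / s))
      = ((\<alpha> ^ 2 + d * b ^ 2) * Q - \<alpha> * b * P) / s ^ 2"
    by (simp add: power2_eq_square flip: add_divide_distrib diff_divide_distrib)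
qed

section \<open>Norms of the elements \<open>a + b sqrt (p r)\<close> with integral trace\<close>

context
  fixes p r :: nat and a b :: real
  assumes pr: "prime p" "prime r" "p \<noteq> r" and p4: "[p = 3] (mod 4)" and r4: "[r = 3] (mod 4)"
    and rat: "a \<in> \<rat>" "b \<in> \<rat>" and int: "2 * a \<in> \<int>"
begin

text \<open>Scaling by \<open>p * r\<close> makes the square of \<open>R\<close> an integer, so the
  rational number \<open>R\<close> is one. Both primes divide \<open>R ^ 2\<close>, hence
  \<open>p * r\<close> divides \<open>R\<close>, so \<open>2 * b\<close> is an integer too.\<close>

lemma quadratic_norm_integers:
  assumes N: "a ^ 2 - real (p * r) * b ^ 2 = of_int N"
  obtains X R :: int where "2 * a = X" "2 * b * real (p * r) = R" "R ^ 2 = int (p * r) * (X ^ 2 - 4 * N)"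
    "int (p * r) dvd R"
proof -
  obtain X where X: "2 * a = of_int X" using int by (rule Ints_cases)
  have "of_int (X ^ 2) = (2 * a) ^ 2" by (simp add: X)
  also have "\<dots> = 4 * (of_int N + real (p * r) * b ^ 2)" using N by (simp add: power2_eq_square)
  finally have "of_int (X ^ 2 - 4 * N) = 4 * real (p * r) * b ^ 2" by simp
  hence "(2 * b * real (p * r)) ^ 2 = of_int (int (p * r) * (X ^ 2 - 4 * N))"
    by (simp add: power2_eq_square)
  moreover have "2 * b * real (p * r) \<in> \<rat>" using rat by simp
  ultimately obtain R where R: "2 * b * real (p * r) = of_int R" "R ^ 2 = int (p * r) * (X ^ 2 - 4 * N)"
    using rational_square_int by metis
  have "int p dvd R ^ 2" "int r dvd R ^ 2" unfolding R(2) by simp_all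
  hence "int p dvd R" "int r dvd R" using pr by (simp_all add: prime_dvd_power_iff)
  moreover have "coprime (int p) (int r)" using pr by (simp add: primes_coprime)
  ultimately have "int (p * r) dvd R" by (simp add: divides_mult)
  thus ?thesis using that X R by blast
qed

text \<open>Norm -1 would make \<open>X ^ 2 + 2 ^ 2\<close> divisible by \<open>p\<close>, a prime
  that is 3 modulo 4, and hence \<open>p\<close> a divisor of 2.\<close>

lemma quadratic_norm_ne_minus_one: "a ^ 2 - real (p * r) * b ^ 2 \<noteq> - 1"
proof
  assume "a ^ 2 - real (p * r) * b ^ 2 = - 1"
  hence "a ^ 2 - real (p * r) * b ^ 2 = of_int (- 1)" by simp
  then obtain X R :: int where "R ^ 2 = int (p * r) * (X ^ 2 - 4 * - 1)" "int (p * r) dvd R"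
    by (rule quadratic_norm_integers)
  then obtain S where "(int (p * r) * S) ^ 2 = int (p * r) * (X ^ 2 + 4)" by (auto elim!: dvdE)
  hence "int (p * r) * (int (p * r) * S ^ 2) = int (p * r) * (X ^ 2 + 4)"
    by (simp only: power_mult_distrib power2_eq_square mult_ac)
  moreover have "int (p * r) \<noteq> 0" using pr by (auto dest: prime_gt_0_nat)
  ultimately have "X ^ 2 + 2 ^ 2 = int p * (int r * S ^ 2)" by simp
  hence "int p dvd X ^ 2 + 2 ^ 2" by simp
  moreover have "[int p = 3] (mod 4)" using p4 by (metis cong_int_iff of_nat_numeral)
  ultimately have "int p dvd 2" using prime_3_mod_4_dvd_sum_squares[of "int p" X 2] pr(1) by simp
  hence "p dvd 2" by (metis int_dvd_int_iff of_nat_numeral)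
  hence "p = 2" using pr(1) by (simp add: primes_dvd_imp_eq)
  thus False using p4 by (simp add: cong_def)
qed

text \<open>By Hilbert 90 a unit \<open>v\<close> of norm 1 is \<open>(1 + v)\<^sup>2 / m\<close> with \<open>m = 2 + tr v\<close>, and \<open>m\<close> has the sign of \<open>v\<close>
  and is \<open>\<plusminus>c\<close> times a square with \<open>c\<close> dividing \<open>p r\<close>.\<close>
lemma quadratic_relative_norm_pos:
  fixes q :: nat and x1 x2 y1 y2 :: real
  assumes q: "prime q" "[q = 3] (mod 4)" "q \<noteq> p" "q \<noteq> r"
    and QR: "QuadRes (int q) (int p)" "QuadRes (int q) (int r)"
    and xy: "x1 \<in> \<rat>" "x2 \<in> \<rat>" "y1 \<in> \<rat>" "y2 \<in> \<rat>"
    and a: "a = x1 ^ 2 + real (p * r) * x2 ^ 2 - real (q * p) * (y1 ^ 2 + real (p * r) * y2 ^ 2)"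
    and b: "b = 2 * (x1 * x2 - real (q * p) * (y1 * y2))"
    and norm: "a ^ 2 - real (p * r) * b ^ 2 = 1"
  shows "a > 0"
proof (rule ccontr)
  assume "\<not> a > 0"
  let ?d = "int (p * r)" and ?e = "int (q * p)"
  have q': "prime (int q)" "[int q = 3] (mod 4)" using q by simp (metis q(2) cong_int_iff of_nat_numeral)
  have ndvd: "\<not> int q dvd int p" "\<not> int q dvd int r" using q pr by (auto simp: primes_dvd_imp_eq)
  obtain rp rr where rp: "[rp ^ 2 = int p] (mod (int q))" and rr: "[rr ^ 2 = int r] (mod (int q))"
    using QR by (auto simp: QuadRes_def)
  have d: "\<not> int q dvd ?d" "[(rp * rr) ^ 2 = ?d] (mod (int q))"
    using ndvd q'(1) rp rr cong_mult[OF rp rr] by (simp_all add: prime_dvd_mult_iff power_mult_distrib)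
  have e: "int q dvd ?e" "\<not> int q ^ 2 dvd ?e"
    using ndvd q(1) by (auto simp: power2_eq_square prime_gt_0_nat)
  \<comment> \<open>Each candidate \<open>c\<close> is a square modulo \<open>q\<close> because
    \<open>p\<close> and \<open>r\<close> are, so the descent excludes \<open>- c\<close> as a value
    of the form.\<close>
  have no_sol: False if c: "c \<in> {1, p, r, p * r}"
    and "x1 \<in> \<rat>" "x2 \<in> \<rat>" "y1 \<in> \<rat>" "y2 \<in> \<rat>"
    and "x1 ^ 2 + real (p * r) * x2 ^ 2 - real (q * p) * (y1 ^ 2 + real (p * r) * y2 ^ 2) = - real c"
      "x1 * x2 = real (q * p) * (y1 * y2)" for c and x1 x2 y1 y2 :: real
  proof -
    have "\<not> q dvd p * r" using ndvd q(1) by (simp add: prime_dvd_mult_iff)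
    hence "\<not> int q dvd int c" using c ndvd q(1) by auto
    moreover have "\<exists>rc. [rc ^ 2 = int c] (mod (int q))"
      using c rp rr d(2) by (metis cong_refl empty_iff insert_iff of_nat_1 power_one)
    then obtain rc where "[rc ^ 2 = int c] (mod (int q))" by blast
    ultimately show False
      using descent_no_rational_solution[OF q' d _ _ e that(2-5), of "int c" rc] that(6,7) by simp
  qed
  have "a ^ 2 - real (p * r) * b ^ 2 = of_int 1" using norm by simp
  then obtain X R :: int where X: "2 * a = X" and R: "2 * b * real (p * r) = R"
    "R ^ 2 = int (p * r) * (X ^ 2 - 4 * 1)" "int (p * r) dvd R"
    by (rule quadratic_norm_integers)
  then obtain Y where Y: "R = int (p * r) * Y" by auto
  have d0: "?d \<noteq> 0" "real (p * r) > 0" using prime_gt_0_nat[OF pr(1)] prime_gt_0_nat[OF pr(2)] by simp_all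
  have "?d * (X ^ 2 - 4) = (?d * Y) ^ 2" using R(2)[symmetric] unfolding Y by (simp only: mult_1_right)
  also have "\<dots> = ?d * (?d * Y ^ 2)" by (simp add: power2_eq_square)
  finally have "?d * (X ^ 2 - 4) = ?d * (?d * Y ^ 2)" .
  hence XY: "X ^ 2 - 4 = ?d * Y ^ 2" using mult_left_cancel[OF d0(1)] by blast
  have bY: "2 * b = of_int Y" using R(1) d0 unfolding Y by simp
  have "a ^ 2 = 1 + real (p * r) * b ^ 2" using norm by simp
  hence "a ^ 2 \<ge> 1" using d0 by simp
  hence "a \<le> - 1" using \<open>\<not> a > 0\<close> abs_le_square_iff[of 1 a] by simp
  hence X2: "X \<le> - 2" using X by linarith
  \<comment> \<open>\<open>A\<close> is minus \<open>2 + tr v\<close>, so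
    \<open>A * (A + 4) = X ^ 2 - 4\<close>, which the norm equation turns into
    \<open>p r Y^2\<close>.\<close>
  define A where "A = nat (- (X + 2))"
  have A: "int A = - (X + 2)" using X2 by (simp add: A_def)
  show False
  proof (cases "A = 0")
    case True
    hence "X = - 2" using A by simp
    hence a1: "a = - 1" using X by simp
    hence b0: "b = 0" using norm d0 by simp
    \<comment> \<open>For \<open>v = -1\<close> the multiplier \<open>1 + v\<close> vanishes, but
      \<open>v\<close> itself is already \<open>- c\<close> with \<open>c = 1\<close>.\<close>
    show False by (rule no_sol[of 1 x1 x2 y1 y2]) (use xy a a1 b b0 in simp_all)
  next
    case False
    have "int (A * (A + 4)) = X ^ 2 - 4" by (simp add: A power2_eq_square algebra_simps)
    also have "\<dots> = int (p * r * nat \<bar>Y\<bar> ^ 2)" by (simp add: XY)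
    finally have "A * (A + 4) = p * r * nat \<bar>Y\<bar> ^ 2" by (simp only: of_nat_eq_iff)
    moreover have "[p * r = 1] (mod 4)" using cong_mult[OF p4 r4] by (simp add: cong_def)
    ultimately obtain c s where c: "c \<in> {1, p, r, p * r}" and s: "A = c * s ^ 2"
      using pell_square_class[OF pr(1,2)] False by blast
    have s0: "s > 0" using False s by (auto intro: Nat.gr0I)
    \<comment> \<open>Now \<open>1 + v\<close> is \<open>\<alpha> + b sqrt (p r)\<close>, of norm
      \<open>2 * \<alpha>\<close>. As \<open>v\<close> has norm 1, \<open>v\<close> times the square
      of the conjugate of \<open>1 + v\<close> is again \<open>2 * \<alpha>\<close>; twisting by
      this conjugate over \<open>s\<close> therefore gives \<open>- c\<close>.\<close>
    define \<alpha> where "\<alpha> = a + 1"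
    have \<alpha>: "2 * \<alpha> = - real c * real s ^ 2"
    proof -
      have "2 * \<alpha> = - of_int (int A)" unfolding A using X by (simp add: \<alpha>_def)
      thus ?thesis by (simp add: s)
    qed
    have db: "real (p * r) * b ^ 2 = \<alpha> ^ 2 - 2 * \<alpha>" using norm by (simp add: \<alpha>_def power2_eq_square algebra_simps)
    have Qb: "x1 * x2 - real (q * p) * (y1 * y2) = b / 2" using b by simp
    let ?x1 = "(\<alpha> * x1 - b * real (p * r) * x2) / s" and ?x2 = "(\<alpha> * x2 - b * x1) / s"
    let ?y1 = "(\<alpha> * y1 - b * real (p * r) * y2) / s" and ?y2 = "(\<alpha> * y2 - b * y1) / s"
    have "?x1 ^ 2 + real (p * r) * ?x2 ^ 2 - real (q * p) * (?y1 ^ 2 + real (p * r) * ?y2 ^ 2)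
        = ((\<alpha> ^ 2 + real (p * r) * b ^ 2) * a - 2 * \<alpha> * (real (p * r) * b ^ 2)) / s ^ 2"
      unfolding quadratic_twist(1) a[symmetric] Qb by (simp add: power2_eq_square)
    also have "\<dots> = 2 * \<alpha> / s ^ 2"
      unfolding db by (simp add: \<alpha>_def power2_eq_square algebra_simps)
    also have "\<dots> = - real c" using s0 by (simp add: \<alpha>)
    finally have 1: "?x1 ^ 2 + real (p * r) * ?x2 ^ 2 - real (q * p) * (?y1 ^ 2 + real (p * r) * ?y2 ^ 2) = - real c" .
    have "?x1 * ?x2 - real (q * p) * (?y1 * ?y2)
        = ((\<alpha> ^ 2 + real (p * r) * b ^ 2) * (b / 2) - \<alpha> * b * a) / s ^ 2"
      unfolding quadratic_twist(2) a[symmetric] Qb by simp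
    also have "\<dots> = 0" unfolding db by (simp add: \<alpha>_def power2_eq_square algebra_simps)
    finally have 2: "?x1 * ?x2 = real (q * p) * (?y1 * ?y2)" by simp
    show False by (rule no_sol[OF c _ _ _ _ 1 2]) (use xy rat in \<open>simp_all add: \<alpha>_def\<close>)
  qed
qed

end

section \<open>Norms to quadratic subfields\<close>

lemma sgn_prod: "sgn (prod f A) = (\<Prod>i\<in>A. sgn (f i :: real))"
  by (induction A rule: infinite_finite_induct) (simp_all add: sgn_mult)

context totally_real_galois
begin

lemma K_norm: "complex_of_real (\<Prod>\<sigma> | \<sigma> \<in> E \<and> P \<sigma>. \<sigma> x) \<in> K"
  unfolding of_real_prod by (rule K_prod) (simp add: embedding_in_K)

text \<open>The norm of \<open>x\<close> is fixed by all embeddings, hence rational, and it is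
  nonzero; the product \<open>M\<close> of the other conjugates lies in \<open>K\<close> by
  normality, and \<open>1 / x\<close> is \<open>M\<close> divided by the norm.\<close>

lemma K_inverse:
  assumes "x \<in> K" "x \<noteq> 0"
  shows "1 / x \<in> K"
proof -
  let ?i = "\<lambda>x. if x \<in> K then Re x else 0"
  define N where "N = (\<Prod>\<sigma>\<in>E. \<sigma> x)"
  define M where "M = (\<Prod>\<sigma>\<in>E - {?i}. \<sigma> x)"
  have NK: "complex_of_real N \<in> K" unfolding N_def using K_norm[of x "\<lambda>_. True"] by simp
  have "\<tau> (complex_of_real N) = N" if \<tau>: "\<tau> \<in> E" for \<tau>
  proof -
    have "\<tau> (complex_of_real N) = (\<Prod>\<sigma>\<in>E. \<tau> (complex_of_real (\<sigma> x)))"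
      unfolding N_def of_real_prod by (rule embedding_prod[OF \<tau>]) (simp add: embedding_in_K)
    also have "\<dots> = N" unfolding N_def
      using prod.reindex_bij_betw[OF bij_comp_embedding[OF \<tau>], of "\<lambda>\<rho>. \<rho> x"] by simp
    finally show ?thesis .
  qed
  hence "N \<in> \<rat>" by (intro embedding_fixed_imp_rational NK)
  then obtain c where c: "N = of_rat c" by (auto simp: Rats_def)
  have "N = ?i x * M" unfolding N_def M_def using finite_embeddings id_embedding by (rule prod.remove)
  hence "complex_of_real N = x * complex_of_real M"
    using assms(1) K_real[OF assms(1)] by (simp add: of_real_Re)
  moreover have "N \<noteq> 0" unfolding N_def using finite_embeddings embedding_eq_0_iff assms by simp
  moreover from calculation have "complex_of_real M \<noteq> 0" by auto
  ultimately have "1 / x = 1 / complex_of_real N * complex_of_real M"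
    using assms(2) by (simp add: field_simps)
  also have "1 / complex_of_real N = of_rat (1 / c)" by (simp add: c of_rat_complex of_rat_divide)
  finally have "1 / x = of_rat (1 / c) * complex_of_real M" .
  moreover have "complex_of_real M \<in> K"
    unfolding M_def of_real_prod using embedding_in_K by (intro K_prod) auto
  ultimately show ?thesis by (simp only: K_mult K_of_rat)
qed

lemma embedding_algebraic_int:
  assumes "\<sigma> \<in> E" "x \<in> K" "algebraic_int x"
  shows "algebraic_int (\<sigma> x)"
proof -
  obtain p where p: "poly (of_int_poly p) x = 0" "monic p"
    using assms(3) unfolding algebraic_int_altdef_ipoly by blast
  have eq: "(of_int_poly p :: complex poly) = map_poly of_rat (of_int_poly p)"
    by (intro poly_eqI) (simp add: coeff_map_poly)
  have "poly (of_int_poly p) (complex_of_real (\<sigma> x)) = 0"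
    using embedding_rat_eval[OF assms(1,2), of "of_int_poly p"] p(1) assms(1) unfolding eq by simp
  hence "algebraic_int (complex_of_real (\<sigma> x))"
    using p(2) unfolding algebraic_int_altdef_ipoly by blast
  thus ?thesis by simp
qed

lemma embedding_sqrt:
  assumes \<sigma>: "\<sigma> \<in> E" and D: "complex_of_real (sqrt (real d)) \<in> K" and d: "d > 0"
  shows "\<sigma> (complex_of_real (sqrt (real d))) = sgn (\<sigma> (complex_of_real (sqrt (real d)))) * sqrt (real d)"
    and "sgn (\<sigma> (complex_of_real (sqrt (real d)))) \<in> {1, - 1}"
proof -
  let ?D = "complex_of_real (sqrt (real d))"
  have "?D * ?D = of_rat (of_nat d)" using d by (simp flip: of_real_mult)
  hence "\<sigma> ?D * \<sigma> ?D = real d"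
    using embedding_mult[OF \<sigma> D D] embedding_of_rat[OF \<sigma>, of "of_nat d"] by simp
  hence "\<bar>\<sigma> ?D\<bar> = sqrt (real d)" by (metis real_sqrt_abs2)
  thus "\<sigma> ?D = sgn (\<sigma> ?D) * sqrt (real d)" by (metis sgn_mult_abs)
  have "\<sigma> ?D \<noteq> 0" using \<open>\<bar>\<sigma> ?D\<bar> = sqrt (real d)\<close> d by auto
  thus "sgn (\<sigma> ?D) \<in> {1, - 1}" by (auto simp: sgn_if)
qed

text \<open>For \<open>d > 0\<close> with \<open>sqrt d\<close> in \<open>K\<close> this is the
  quadratic character of the Galois group attached to \<open>sqrt d\<close>.\<close>

abbreviation sqrt_sign :: "nat \<Rightarrow> (complex \<Rightarrow> real) \<Rightarrow> real" where
  "sqrt_sign d \<sigma> \<equiv> sgn (\<sigma> (complex_of_real (sqrt (real d))))"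

lemma sqrt_sign_comp:
  assumes "\<sigma> \<in> E" "\<tau> \<in> E" and D: "complex_of_real (sqrt (real d)) \<in> K" and d: "d > 0"
  shows "sqrt_sign d (\<lambda>x. \<tau> (complex_of_real (\<sigma> x))) = sqrt_sign d \<sigma> * sqrt_sign d \<tau>"
proof -
  let ?D = "complex_of_real (sqrt (real d))"
  have "\<tau> (complex_of_real (\<sigma> ?D)) = sqrt_sign d \<sigma> * \<tau> ?D"
    using embedding_sqrt[OF assms(1,3,4)] embedding_uminus[OF assms(2,3)] by auto
  moreover have "sgn (sqrt_sign d \<sigma>) = sqrt_sign d \<sigma>" using embedding_sqrt(2)[OF assms(1,3,4)] by auto
  ultimately show ?thesis by (simp add: sgn_mult)
qed

context
  fixes d e :: nat and u :: complex
  assumes d: "d > 0" "complex_of_real (sqrt (real d)) \<in> K"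
    and e: "e > 0" "complex_of_real (sqrt (real e)) \<in> K"
    and u: "u \<in> K"
begin

text \<open>The classes are cosets of the subgroup fixing both square roots, so these are the
  conjugates of the norm to the field generated by \<open>sqrt d\<close> and \<open>sqrt e\<close>.
  Empty classes give 1; this happens for \<open>s \<noteq> t\<close> when
  \<open>d = e\<close>.\<close>

definition partial_norm :: "real \<Rightarrow> real \<Rightarrow> real" where
  "partial_norm s t = (\<Prod>\<sigma> | \<sigma> \<in> E \<and> (sqrt_sign d \<sigma> = s \<and> sqrt_sign e \<sigma> = t). \<sigma> u)"

lemma partial_norm_in_K: "complex_of_real (partial_norm s t) \<in> K"
  unfolding partial_norm_def by (rule K_norm)

text \<open>Composition with \<open>\<tau>\<close> permutes \<open>E\<close> and multiplies both
  signs of a class by those of \<open>\<tau>\<close>.\<close>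

lemma embedding_partial_norm:
  assumes \<tau>: "\<tau> \<in> E"
  shows "\<tau> (complex_of_real (partial_norm s t)) = partial_norm (s * sqrt_sign d \<tau>) (t * sqrt_sign e \<tau>)"
proof -
  let ?P = "\<lambda>s t \<sigma>. sqrt_sign d \<sigma> = s \<and> sqrt_sign e \<sigma> = t"
  let ?c = "\<lambda>\<sigma> x. \<tau> (complex_of_real (\<sigma> x))"
  have iff: "?P (s * sqrt_sign d \<tau>) (t * sqrt_sign e \<tau>) (?c \<sigma>) \<longleftrightarrow> ?P s t \<sigma>" if "\<sigma> \<in> E" for \<sigma>
    unfolding sqrt_sign_comp[OF that \<tau> d(2,1)] sqrt_sign_comp[OF that \<tau> e(2,1)]
    using embedding_sqrt(2)[OF \<tau> d(2,1)] embedding_sqrt(2)[OF \<tau> e(2,1)] by auto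
  have "\<tau> (complex_of_real (partial_norm s t)) = (\<Prod>\<sigma> | \<sigma> \<in> E \<and> ?P s t \<sigma>. ?c \<sigma> u)"
    unfolding partial_norm_def of_real_prod by (rule embedding_prod[OF \<tau>]) (simp add: embedding_in_K)
  also have "\<dots> = (\<Prod>\<sigma>\<in>E. if ?P s t \<sigma> then ?c \<sigma> u else 1)"
    using finite_embeddings by (rule prod.inter_filter)
  also have "\<dots> = (\<Prod>\<sigma>\<in>E. if ?P (s * sqrt_sign d \<tau>) (t * sqrt_sign e \<tau>) (?c \<sigma>) then ?c \<sigma> u else 1)"
    by (intro prod.cong refl) (simp only: iff)
  also have "\<dots> = (\<Prod>\<rho>\<in>E. if ?P (s * sqrt_sign d \<tau>) (t * sqrt_sign e \<tau>) \<rho> then \<rho> u else 1)"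
    by (rule prod.reindex_bij_betw[OF bij_comp_embedding[OF \<tau>]])
  also have "\<dots> = partial_norm (s * sqrt_sign d \<tau>) (t * sqrt_sign e \<tau>)"
    unfolding partial_norm_def using finite_embeddings by (rule prod.inter_filter[symmetric])
  finally show ?thesis .
qed

text \<open>A Fourier transform on the group of sign pairs. The character sum \<open>r s t\<close>
  is multiplied by a character under each embedding, as is the matching product \<open>c s t\<close>
  of square roots; so \<open>r s t * c s t\<close> is fixed by all embeddings and rational.\<close>

lemma partial_norm_coordinates:
  obtains x1 x2 y1 y2 :: real where "x1 \<in> \<rat>" "x2 \<in> \<rat>" "y1 \<in> \<rat>" "y2 \<in> \<rat>"
    "\<And>s t. s \<in> {1, -1} \<Longrightarrow> t \<in> {1, -1} \<Longrightarrow> partial_norm s t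
      = (x1 + x2 * (s * sqrt (real d))) + (y1 + y2 * (s * sqrt (real d))) * (t * sqrt (real e))"
proof -
  let ?D = "sqrt (real d)" and ?F = "sqrt (real e)" and ?w = partial_norm
  define r where "r = (\<lambda>s t. ?w 1 1 + t * ?w 1 (-1) + s * ?w (-1) 1 + s * t * ?w (-1) (-1))"
  have K1: "complex_of_real (s * ?w a b) \<in> K" if "s \<in> {1, -1}" for s a b
    using that partial_norm_in_K K_uminus[OF partial_norm_in_K] by auto
  have rK: "complex_of_real (r s t) \<in> K" if "s \<in> {1, -1}" "t \<in> {1, -1}" for s t
  proof -
    have "s * t \<in> {1, -1}" using that by auto
    thus ?thesis unfolding r_def of_real_add using that by (intro K_add K1 partial_norm_in_K)
  qed
  have r: "\<tau> (complex_of_real (r s t)) = (if s = 1 then 1 else sqrt_sign d \<tau>) * (if t = 1 then 1 else sqrt_sign e \<tau>) * r s t"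
    if st: "s \<in> {1, -1}" "t \<in> {1, -1}" and \<tau>: "\<tau> \<in> E" for s t \<tau>
  proof -
    have sign: "sqrt_sign d \<tau> = 1 \<or> sqrt_sign d \<tau> = - 1" "sqrt_sign e \<tau> = 1 \<or> sqrt_sign e \<tau> = - 1"
      using embedding_sqrt(2)[OF \<tau> d(2,1)] embedding_sqrt(2)[OF \<tau> e(2,1)] by auto
    have "\<tau> (complex_of_real (r s t)) = \<tau> (complex_of_real (?w 1 1)) + t * \<tau> (complex_of_real (?w 1 (-1)))
        + s * \<tau> (complex_of_real (?w (-1) 1)) + s * t * \<tau> (complex_of_real (?w (-1) (-1)))"
      using st by (auto simp: r_def \<tau> embedding_add embedding_diff embedding_uminus K_add K_diff K_uminus partial_norm_in_K)
    also have "\<dots> = (if s = 1 then 1 else sqrt_sign d \<tau>) * (if t = 1 then 1 else sqrt_sign e \<tau>) * r s t"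
      unfolding embedding_partial_norm[OF \<tau>] using st sign by (elim disjE insertE emptyE) (simp_all add: r_def)
    finally show ?thesis .
  qed
  define c where "c = (\<lambda>(s :: real) (t :: real). (if s = 1 then 1 else ?D) * (if t = 1 then 1 else ?F))"
  have rat: "r s t * c s t \<in> \<rat>" if st: "s \<in> {1, -1}" "t \<in> {1, -1}" for s t
  proof (rule embedding_fixed_imp_rational)
    have cK: "complex_of_real (c s t) \<in> K" using d e by (auto simp: c_def K_mult)
    show "complex_of_real (r s t * c s t) \<in> K" using rK[OF st] cK by (simp add: K_mult)
    fix \<tau> assume \<tau>: "\<tau> \<in> E"
    have \<tau>D: "\<tau> (complex_of_real ?D) = sqrt_sign d \<tau> * ?D" and \<tau>F: "\<tau> (complex_of_real ?F) = sqrt_sign e \<tau> * ?F"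
      using embedding_sqrt(1)[OF \<tau> d(2,1)] embedding_sqrt(1)[OF \<tau> e(2,1)] by simp_all
    have sq: "sqrt_sign d \<tau> * sqrt_sign d \<tau> = 1" "sqrt_sign e \<tau> * sqrt_sign e \<tau> = 1"
      using embedding_sqrt(2)[OF \<tau> d(2,1)] embedding_sqrt(2)[OF \<tau> e(2,1)] by auto
    have "\<tau> (complex_of_real (c s t)) = (if s = 1 then 1 else \<tau> (complex_of_real ?D)) * (if t = 1 then 1 else \<tau> (complex_of_real ?F))"
      using \<tau> d e by (simp add: c_def embedding_mult)
    also have "\<dots> = (if s = 1 then 1 else sqrt_sign d \<tau>) * (if t = 1 then 1 else sqrt_sign e \<tau>) * c s t"
      by (subst \<tau>D, subst \<tau>F) (simp add: c_def)
    finally have \<tau>c: "\<tau> (complex_of_real (c s t)) = (if s = 1 then 1 else sqrt_sign d \<tau>) * (if t = 1 then 1 else sqrt_sign e \<tau>) * c s t" .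
    have "\<tau> (complex_of_real (r s t * c s t)) = \<tau> (complex_of_real (r s t)) * \<tau> (complex_of_real (c s t))"
      using embedding_mult[OF \<tau> rK[OF st] cK] by simp
    also have "\<dots> = ((if s = 1 then 1 else sqrt_sign d \<tau>) * (if s = 1 then 1 else sqrt_sign d \<tau>))
        * ((if t = 1 then 1 else sqrt_sign e \<tau>) * (if t = 1 then 1 else sqrt_sign e \<tau>)) * (r s t * c s t)"
      unfolding r[OF st \<tau>] \<tau>c by (simp only: mult_ac)
    also have "\<dots> = r s t * c s t" using sq by (cases "s = 1"; cases "t = 1") simp_all
    finally show "\<tau> (complex_of_real (r s t * c s t)) = r s t * c s t" .
  qed
  \<comment> \<open>The square of \<open>c s t\<close> is rational, so one may divide by
    \<open>c s t\<close> instead of multiplying; the 4 is the order of the group, from Fourier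
    inversion.\<close>
  have rat': "r s t / c s t / 4 \<in> \<rat>" if st: "s \<in> {1, -1}" "t \<in> {1, -1}" for s t
  proof -
    have "c s t * c s t = ((if s = 1 then 1 else ?D) * (if s = 1 then 1 else ?D))
        * ((if t = 1 then 1 else ?F) * (if t = 1 then 1 else ?F))"
      unfolding c_def by (simp only: mult_ac)
    hence "c s t * c s t \<in> \<rat>" by (cases "s = 1"; cases "t = 1") simp_all
    hence "(r s t * c s t) / (c s t * c s t) / 4 \<in> \<rat>" using rat[OF st] by (intro Rats_divide) simp_all
    moreover have "c s t \<noteq> 0" using d(1) e(1) by (simp add: c_def)
    hence "(r s t * c s t) / (c s t * c s t) / 4 = r s t / c s t / 4" by simp
    ultimately show ?thesis by (simp only:)
  qed
  show ?thesis
  proof (rule that)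
    show "r 1 1 / c 1 1 / 4 \<in> \<rat>" "r (-1) 1 / c (-1) 1 / 4 \<in> \<rat>" "r 1 (-1) / c 1 (-1) / 4 \<in> \<rat>"
      "r (-1) (-1) / c (-1) (-1) / 4 \<in> \<rat>" by (rule rat'; simp)+
    fix s t :: real assume "s \<in> {1, -1}" "t \<in> {1, -1}"
    moreover have "?D \<noteq> 0" "?F \<noteq> 0" using d(1) e(1) by simp_all
    hence "r 1 1 / c 1 1 / 4 + r (-1) 1 / c (-1) 1 / 4 * (s * ?D)
        + (r 1 (-1) / c 1 (-1) / 4 + r (-1) (-1) / c (-1) (-1) / 4 * (s * ?D)) * (t * ?F)
        = (r 1 1 + s * r (-1) 1 + t * r 1 (-1) + s * t * r (-1) (-1)) / 4"
      by (simp add: c_def field_simps)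
    ultimately show "?w s t = r 1 1 / c 1 1 / 4 + r (-1) 1 / c (-1) 1 / 4 * (s * ?D)
        + (r 1 (-1) / c 1 (-1) / 4 + r (-1) (-1) / c (-1) (-1) / 4 * (s * ?D)) * (t * ?F)"
      by (elim insertE emptyE) (simp_all add: r_def)
  qed
qed

end

lemma prod_sqrt_sign_split:
  assumes d: "d > 0" "complex_of_real (sqrt (real d)) \<in> K"
  shows "(\<Prod>\<sigma> | \<sigma> \<in> E \<and> P \<sigma>. g \<sigma>) = (\<Prod>\<sigma> | \<sigma> \<in> E \<and> (P \<sigma> \<and> sqrt_sign d \<sigma> = 1). g \<sigma>)
    * (\<Prod>\<sigma> | \<sigma> \<in> E \<and> (P \<sigma> \<and> sqrt_sign d \<sigma> = -1). g \<sigma> :: real)"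
proof -
  have "{\<sigma>. \<sigma> \<in> E \<and> P \<sigma>} = {\<sigma>. \<sigma> \<in> E \<and> (P \<sigma> \<and> sqrt_sign d \<sigma> = 1)} \<union> {\<sigma>. \<sigma> \<in> E \<and> (P \<sigma> \<and> sqrt_sign d \<sigma> = -1)}"
    using embedding_sqrt(2)[OF _ d(2,1)] by auto
  thus ?thesis using finite_embeddings by (simp only:) (subst prod.union_disjoint, auto)
qed

text \<open>The norm from \<open>K\<close> to \<open>\<rat>(\<surd>d)\<close> followed by the real embedding \<open>\<surd>d \<mapsto> s \<surd>d\<close>.\<close>
definition quadratic_norm :: "nat \<Rightarrow> complex \<Rightarrow> real \<Rightarrow> real" where
  "quadratic_norm d u s = (\<Prod>\<sigma> | \<sigma> \<in> E \<and> sqrt_sign d \<sigma> = s. \<sigma> u)"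

text \<open>Transitivity of norms: with \<open>x\<close> and \<open>y\<close> in the field of
  \<open>sqrt d\<close>, the norm is the product of the partial norms \<open>x + y sqrt e\<close>
  and \<open>x - y sqrt e\<close>, hence a value of \<open>x^2 - e y^2\<close>.\<close>

lemma quadratic_norm_coordinates:
  assumes d: "d > 0" "complex_of_real (sqrt (real d)) \<in> K"
    and e: "e > 0" "complex_of_real (sqrt (real e)) \<in> K"
    and u: "u \<in> K"
  obtains x1 x2 y1 y2 :: real where "x1 \<in> \<rat>" "x2 \<in> \<rat>" "y1 \<in> \<rat>" "y2 \<in> \<rat>"
    "\<And>s. s \<in> {1, -1} \<Longrightarrow> quadratic_norm d u s = x1 ^ 2 + d * x2 ^ 2 - e * (y1 ^ 2 + d * y2 ^ 2)
      + 2 * (x1 * x2 - e * (y1 * y2)) * (s * sqrt (real d))"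
proof -
  obtain x1 x2 y1 y2 :: real where x: "x1 \<in> \<rat>" "x2 \<in> \<rat>" "y1 \<in> \<rat>" "y2 \<in> \<rat>"
    and w: "\<And>s t. s \<in> {1, -1} \<Longrightarrow> t \<in> {1, -1} \<Longrightarrow> partial_norm d e u s t
      = (x1 + x2 * (s * sqrt (real d))) + (y1 + y2 * (s * sqrt (real d))) * (t * sqrt (real e))"
    by (rule partial_norm_coordinates[OF d e u]) (rule that; simp)
  show ?thesis
  proof (rule that[OF x])
    fix s :: real assume s: "s \<in> {1, -1}"
    have s2: "s * sqrt (real d) * (s * sqrt (real d)) = d" using s by auto
    have e2: "sqrt (real e) * sqrt (real e) = e" by simp
    have "quadratic_norm d u s = partial_norm d e u s 1 * partial_norm d e u s (-1)"
      unfolding quadratic_norm_def partial_norm_def[OF d e u] by (rule prod_sqrt_sign_split[OF e])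
    also have "\<dots> = (x1 + x2 * (s * sqrt (real d))) * (x1 + x2 * (s * sqrt (real d)))
        - (y1 + y2 * (s * sqrt (real d))) * (y1 + y2 * (s * sqrt (real d))) * (sqrt (real e) * sqrt (real e))"
      using s by (simp add: w) (simp add: algebra_simps)
    also have "\<dots> = x1 ^ 2 + (s * sqrt (real d) * (s * sqrt (real d))) * x2 ^ 2 - e * (y1 ^ 2 + (s * sqrt (real d) * (s * sqrt (real d))) * y2 ^ 2)
      + 2 * (x1 * x2 - e * (y1 * y2)) * (s * sqrt (real d))"
      unfolding e2 by (simp add: algebra_simps power2_eq_square)
    finally show "quadratic_norm d u s = x1 ^ 2 + d * x2 ^ 2 - e * (y1 ^ 2 + d * y2 ^ 2)
      + 2 * (x1 * x2 - e * (y1 * y2)) * (s * sqrt (real d))" unfolding s2 .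
  qed
qed

lemma algebraic_int_quadratic_norm:
  assumes "u \<in> K" "algebraic_int u"
  shows "algebraic_int (quadratic_norm d u s)"
  unfolding quadratic_norm_def using assms by (intro algebraic_int_prod embedding_algebraic_int) auto

lemma norm_eq_quadratic_norms:
  assumes "d > 0" "complex_of_real (sqrt (real d)) \<in> K"
  shows "(\<Prod>\<sigma>\<in>E. \<sigma> u) = quadratic_norm d u 1 * quadratic_norm d u (-1)"
  using prod_sqrt_sign_split[where P = "\<lambda>_. True" and g = "\<lambda>\<sigma>. \<sigma> u", OF assms] by (simp add: quadratic_norm_def)

text \<open>The two quadratic norms have sum \<open>2 * a\<close>, and their product is the full
  norm; both are rational and algebraic integers.\<close>

lemma quadratic_norm_trace_norm:
  assumes d: "d > 0" "complex_of_real (sqrt (real d)) \<in> K"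
    and u: "u \<in> K" "algebraic_int u" and ab: "a \<in> \<rat>" "b \<in> \<rat>"
    and eq: "\<And>s. s \<in> {1, -1} \<Longrightarrow> quadratic_norm d u s = a + b * (s * sqrt (real d))"
  shows "2 * a \<in> \<int>" "a ^ 2 - real d * b ^ 2 = (\<Prod>\<sigma>\<in>E. \<sigma> u)" "(\<Prod>\<sigma>\<in>E. \<sigma> u) \<in> \<int>"
proof -
  have "2 * a = quadratic_norm d u 1 + quadratic_norm d u (-1)" by (simp add: eq)
  moreover have "algebraic_int (quadratic_norm d u 1 + quadratic_norm d u (-1))"
    using u by (intro algebraic_int_add algebraic_int_quadratic_norm)
  ultimately have "algebraic_int (2 * a)" by (simp only:)
  thus "2 * a \<in> \<int>" using ab by (intro rational_algebraic_int_is_int) simp_all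
  have "a ^ 2 - real d * b ^ 2 = a ^ 2 - (sqrt (real d) * sqrt (real d)) * b ^ 2" by simp
  also have "\<dots> = quadratic_norm d u 1 * quadratic_norm d u (-1)"
    by (simp add: eq) (simp add: algebra_simps power2_eq_square)
  finally show N: "a ^ 2 - real d * b ^ 2 = (\<Prod>\<sigma>\<in>E. \<sigma> u)" using norm_eq_quadratic_norms[OF d] by simp
  have "(\<Prod>\<sigma>\<in>E. \<sigma> u) \<in> \<rat>" using ab by (simp flip: N)
  moreover have "algebraic_int (\<Prod>\<sigma>\<in>E. \<sigma> u)" using u by (intro algebraic_int_prod embedding_algebraic_int) auto
  ultimately show "(\<Prod>\<sigma>\<in>E. \<sigma> u) \<in> \<int>" by (intro rational_algebraic_int_is_int)
qed

text \<open>The norms of \<open>u\<close> and \<open>1 / u\<close> are integers with product 1, and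
  norm -1 is impossible already in the quadratic subfield generated by
  \<open>sqrt (p r)\<close>.\<close>

lemma unit_norm_eq_1:
  assumes u: "u \<in> units_of_field K"
    and pr: "prime p" "prime r" "p \<noteq> r" "[p = 3] (mod 4)" "[r = 3] (mod 4)"
    and d: "complex_of_real (sqrt (real (p * r))) \<in> K"
  shows "(\<Prod>\<sigma>\<in>E. \<sigma> u) = 1"
proof -
  have uK: "u \<in> K" "u \<noteq> 0" "algebraic_int u" "algebraic_int (1 / u)" using u by (simp_all add: units_of_field_def)
  have d0: "p * r > 0" using prime_gt_0_nat[OF pr(1)] prime_gt_0_nat[OF pr(2)] by simp
  have iK: "1 / u \<in> K" using uK(1,2) by (rule K_inverse)
  \<comment> \<open>Only the shape \<open>a + b sqrt (p r)\<close> is wanted here, so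
    \<open>p * r\<close> serves as both \<open>d\<close> and \<open>e\<close>.\<close>
  have coords: thesis if vK: "v \<in> K"
    and ex: "\<And>a b. a \<in> \<rat> \<Longrightarrow> b \<in> \<rat> \<Longrightarrow> (\<And>s. s \<in> {1, -1} \<Longrightarrow> quadratic_norm (p * r) v s = a + b * (s * sqrt (real (p * r)))) \<Longrightarrow> thesis"
    for v thesis
  proof -
    obtain x1 x2 y1 y2 :: real where x: "x1 \<in> \<rat>" "x2 \<in> \<rat>" "y1 \<in> \<rat>" "y2 \<in> \<rat>"
      and w: "\<And>s. s \<in> {1, -1} \<Longrightarrow> quadratic_norm (p * r) v s = x1 ^ 2 + real (p * r) * x2 ^ 2 - real (p * r) * (y1 ^ 2 + real (p * r) * y2 ^ 2)
        + 2 * (x1 * x2 - real (p * r) * (y1 * y2)) * (s * sqrt (real (p * r)))"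
      by (rule quadratic_norm_coordinates[OF d0 d d0 d vK]) (rule that; simp)
    show thesis by (rule ex[OF _ _ w]) (use x in simp_all)
  qed
  obtain a b where ab: "a \<in> \<rat>" "b \<in> \<rat>"
    and eq: "\<And>s. s \<in> {1, -1} \<Longrightarrow> quadratic_norm (p * r) u s = a + b * (s * sqrt (real (p * r)))"
    by (rule coords[OF uK(1)]) (rule that; simp)
  note N = quadratic_norm_trace_norm[OF d0 d uK(1,3) ab eq]
  obtain a' b' where ab': "a' \<in> \<rat>" "b' \<in> \<rat>"
    and eq': "\<And>s. s \<in> {1, -1} \<Longrightarrow> quadratic_norm (p * r) (1 / u) s = a' + b' * (s * sqrt (real (p * r)))"
    by (rule coords[OF iK]) (rule that; simp)
  note N' = quadratic_norm_trace_norm(3)[OF d0 d iK uK(4) ab' eq']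
  have "\<sigma> u * \<sigma> (1 / u) = 1" if "\<sigma> \<in> E" for \<sigma>
    using embedding_mult[OF that uK(1) iK] uK(2) that by simp
  hence prod: "(\<Prod>\<sigma>\<in>E. \<sigma> u) * (\<Prod>\<sigma>\<in>E. \<sigma> (1 / u)) = 1" by (simp flip: prod.distrib)
  obtain m where m: "(\<Prod>\<sigma>\<in>E. \<sigma> u) = of_int m" using N(3) by (rule Ints_cases)
  obtain m' where m': "(\<Prod>\<sigma>\<in>E. \<sigma> (1 / u)) = of_int m'" using N' by (rule Ints_cases)
  have "m * m' = 1" using prod unfolding m m' by (metis of_int_eq_1_iff of_int_mult)
  hence "m = 1 \<or> m = - 1" by (auto simp: zmult_eq_1_iff)
  moreover have "m \<noteq> - 1"
  proof
    assume "m = - 1"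
    hence "a ^ 2 - real (p * r) * b ^ 2 = - 1" using N(2) m by simp
    thus False using quadratic_norm_ne_minus_one[OF pr ab N(1)] by contradiction
  qed
  ultimately show ?thesis by (simp add: m)
qed

text \<open>The two quadratic norms have product 1 and hence equal signs; the sign is that of their
  sum \<open>2 * a\<close>, which the descent with \<open>e = q * p\<close> shows to be
  positive.\<close>

lemma unit_quadratic_norm_pos:
  assumes u: "u \<in> units_of_field K"
    and pr: "prime p" "prime r" "p \<noteq> r" "[p = 3] (mod 4)" "[r = 3] (mod 4)"
    and q: "prime q" "[q = 3] (mod 4)" "q \<noteq> p" "q \<noteq> r" "QuadRes (int q) (int p)" "QuadRes (int q) (int r)"
    and d: "complex_of_real (sqrt (real (p * r))) \<in> K"
    and e: "complex_of_real (sqrt (real (q * p))) \<in> K"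
  shows "quadratic_norm (p * r) u (- 1) > 0"
proof -
  have uK: "u \<in> K" "algebraic_int u" using u by (simp_all add: units_of_field_def)
  have d0: "p * r > 0" and e0: "q * p > 0"
    using prime_gt_0_nat[OF pr(1)] prime_gt_0_nat[OF pr(2)] prime_gt_0_nat[OF q(1)] by simp_all
  obtain x1 x2 y1 y2 :: real where x: "x1 \<in> \<rat>" "x2 \<in> \<rat>" "y1 \<in> \<rat>" "y2 \<in> \<rat>"
    and w: "\<And>s. s \<in> {1, -1} \<Longrightarrow> quadratic_norm (p * r) u s = x1 ^ 2 + real (p * r) * x2 ^ 2 - real (q * p) * (y1 ^ 2 + real (p * r) * y2 ^ 2)
      + 2 * (x1 * x2 - real (q * p) * (y1 * y2)) * (s * sqrt (real (p * r)))"
    by (rule quadratic_norm_coordinates[OF d0 d e0 e uK(1)]) (rule that; simp)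
  define a where "a = x1 ^ 2 + real (p * r) * x2 ^ 2 - real (q * p) * (y1 ^ 2 + real (p * r) * y2 ^ 2)"
  define b where "b = 2 * (x1 * x2 - real (q * p) * (y1 * y2))"
  have ab: "a \<in> \<rat>" "b \<in> \<rat>" using x by (simp_all add: a_def b_def)
  have eq: "quadratic_norm (p * r) u s = a + b * (s * sqrt (real (p * r)))" if "s \<in> {1, -1}" for s
    unfolding a_def b_def by (rule w[OF that])
  note N = quadratic_norm_trace_norm[OF d0 d uK ab eq]
  have 1: "(\<Prod>\<sigma>\<in>E. \<sigma> u) = 1" by (rule unit_norm_eq_1[OF u pr d])
  have "a > 0"
    by (rule quadratic_relative_norm_pos[OF pr ab N(1) q x a_def b_def N(2)[unfolded 1]])
  hence "quadratic_norm (p * r) u 1 + quadratic_norm (p * r) u (-1) > 0" by (simp add: eq)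
  moreover have "quadratic_norm (p * r) u 1 * quadratic_norm (p * r) u (-1) = 1"
    using norm_eq_quadratic_norms[OF d0 d, of u] 1 by simp
  ultimately show ?thesis by (smt (verit) mult_nonneg_nonpos mult_nonpos_nonneg zero_less_mult_iff)
qed

end

section \<open>Real cyclotomic fields\<close>

text \<open>The rescaled Chebyshev polynomials \<open>2 T_k(x / 2)\<close>, which express
  \<open>w^k + 1 / w^k\<close> through \<open>w + 1 / w\<close>.\<close>

fun trace_poly :: "nat \<Rightarrow> rat poly" where
  "trace_poly 0 = [:2:]"
| "trace_poly (Suc 0) = [:0, 1:]"
| "trace_poly (Suc (Suc k)) = [:0, 1:] * trace_poly (Suc k) - trace_poly k"

lemma rat_eval_trace_poly:
  assumes "w \<noteq> 0"
  shows "rat_eval (trace_poly k) (w + 1 / w) = w ^ k + 1 / w ^ k"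
proof (induction k rule: trace_poly.induct)
  case (3 k)
  have "(w + 1 / w) * (w ^ Suc k + 1 / w ^ Suc k) = w ^ Suc (Suc k) + 1 / w ^ Suc (Suc k) + (w ^ k + 1 / w ^ k)"
    using assms by (simp add: field_simps)
  thus ?case using 3 by simp
qed (simp_all)

lemma add_inverse_eq_2_imp:
  fixes x :: complex
  assumes "x \<noteq> 0" "x + 1 / x = 2"
  shows "x = 1"
proof -
  have "(x - 1) ^ 2 = x * (x + 1 / x - 2)" using assms(1) by (simp add: power2_eq_square field_simps)
  thus ?thesis using assms(2) by simp
qed

lemma cis_unity_powers:
  assumes "n > 0" "w ^ n = 1"
  obtains k where "w = cis (2 * pi / real n) ^ k"
proof -
  have "w \<in> (\<lambda>k. cis (2 * pi * real k / real n)) ` {..<n}"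
    using bij_betw_roots_unity[OF assms(1)] assms(2) by (auto simp: bij_betw_def)
  then obtain k where "w = cis (2 * pi * real k / real n)" by auto
  also have "\<dots> = cis (2 * pi / real n) ^ k" by (simp add: Complex.DeMoivre mult_ac)
  finally show ?thesis by (rule that)
qed

text \<open>Every complex \<open>r\<close> has the form \<open>w + 1 / w\<close>, and
  \<open>trace_poly n\<close> takes the value 2 there only if \<open>w ^ n = 1\<close>. So the roots
  are real traces of powers of \<open>\<zeta>\<close>, which lie in the field.\<close>

lemma real_cyclotomic_field_totally_real_galois:
  assumes n: "n > 0"
  defines "\<zeta> \<equiv> cis (2 * pi / real n)"
  shows "totally_real_galois (real_cyclotomic_field n) (\<zeta> + 1 / \<zeta>) (trace_poly n - [:2:])"
proof -
  let ?\<theta> = "\<zeta> + 1 / \<zeta>"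
  have \<zeta>0: "\<zeta> \<noteq> 0" by (simp add: \<zeta>_def)
  have \<zeta>n: "\<zeta> ^ n = 1" using n by (simp add: \<zeta>_def Complex.DeMoivre)
  have inv: "1 / w = cnj w" if "w ^ n = 1" for w :: complex
  proof -
    have "norm w = 1" using that n by (metis norm_one norm_power power_eq_1_iff norm_ge_zero neq0_conv)
    thus ?thesis by (simp add: divide_conv_cnj)
  qed
  have unity_real: "w + 1 / w \<in> \<real>" if "w ^ n = 1" for w :: complex
    unfolding inv[OF that] by (simp add: complex_is_Real_iff)
  have trace: "\<zeta> ^ k + 1 / \<zeta> ^ k \<in> rat_adjoin ?\<theta>" for k
    using rat_eval_trace_poly[OF \<zeta>0, of k] by (metis rangeI rat_adjoin_def)
  have cnj_eval: "cnj (rat_eval p x) = rat_eval p (cnj x)" for p x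
    by (induction p) (simp_all add: of_rat_complex)
  have cyc: "cyclotomic_field n = rat_adjoin \<zeta>"
    by (auto simp: cyclotomic_field_def rat_adjoin_def \<zeta>_def)
  have sub: "rat_adjoin ?\<theta> \<subseteq> real_cyclotomic_field n"
  proof
    fix x assume "x \<in> rat_adjoin ?\<theta>"
    then obtain p where x: "x = rat_eval p ?\<theta>" by (auto simp: rat_adjoin_def)
    have "1 / \<zeta> = \<zeta> ^ (n - 1)" using \<zeta>n \<zeta>0 n by (simp add: field_simps flip: power_Suc)
    hence "?\<theta> \<in> rat_adjoin \<zeta>"
      using rat_adjoin_add[OF rat_adjoin_generator rat_adjoin_power[OF rat_adjoin_generator], of \<zeta> "n - 1"] by simp
    hence "x \<in> rat_adjoin \<zeta>" unfolding x by (rule rat_adjoin_rat_eval)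
    moreover have "cnj x = x" 
    proof -
      have "cnj ?\<theta> = ?\<theta>" using unity_real[OF \<zeta>n] by (simp add: Reals_cnj_iff)
      thus ?thesis unfolding x cnj_eval by simp
    qed
    hence "x \<in> \<real>" by (simp add: Reals_cnj_iff)
    ultimately show "x \<in> real_cyclotomic_field n" by (simp add: real_cyclotomic_field_def cyc)
  qed
  have sup: "real_cyclotomic_field n \<subseteq> rat_adjoin ?\<theta>"
  proof
    fix x assume "x \<in> real_cyclotomic_field n"
    then obtain p where x: "x = rat_eval p \<zeta>" and r: "x \<in> \<real>"
      by (auto simp: real_cyclotomic_field_def cyc rat_adjoin_def)
    \<comment> \<open>A real \<open>x\<close> equals its conjugate, so adding the two pairs each
      power of \<open>\<zeta>\<close> with its inverse.\<close>
    have "x + x = rat_eval p \<zeta> + rat_eval p (1 / \<zeta>)"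
      using r unfolding inv[OF \<zeta>n] cnj_eval[symmetric] x[symmetric] by (simp add: Reals_cnj_iff)
    also have "\<dots> = (\<Sum>i\<le>degree p. of_rat (Polynomial.coeff p i) * (\<zeta> ^ i + 1 / \<zeta> ^ i))"
      by (simp add: poly_altdef coeff_map_poly power_divide ring_distribs sum.distrib)
    also have "\<dots> \<in> rat_adjoin ?\<theta>"
      by (intro rat_adjoin_sum rat_adjoin_mult rat_adjoin_of_rat trace)
    finally have "of_rat (1 / 2) * (x + x) \<in> rat_adjoin ?\<theta>" by (intro rat_adjoin_mult rat_adjoin_of_rat)
    thus "x \<in> rat_adjoin ?\<theta>" by (simp add: of_rat_divide)
  qed
  show ?thesis
  proof
    show K: "real_cyclotomic_field n = rat_adjoin ?\<theta>" using sub sup by blast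
    show "rat_eval (trace_poly n - [:2:]) ?\<theta> = 0" using rat_eval_trace_poly[OF \<zeta>0, of n] \<zeta>n by simp
    have unity: "w ^ n = 1" if "w \<noteq> 0" "rat_eval (trace_poly n - [:2:]) (w + 1 / w) = 0" for w
      using that rat_eval_trace_poly[OF that(1), of n] by (intro add_inverse_eq_2_imp) simp_all
    \<comment> \<open>A zero polynomial would vanish at \<open>2 + 1 / 2\<close>, making 2 a root of
      unity.\<close>
    show "trace_poly n - [:2:] \<noteq> 0"
    proof
      assume "trace_poly n - [:2:] = 0"
      hence "(2 :: complex) ^ n = 1" by (intro unity) simp_all
      hence "norm ((2 :: complex) ^ n) = 1" by simp
      hence "(2 :: real) ^ n = 1" by (simp add: norm_power)
      thus False using one_less_power[of "2 :: real" n] n by simp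
    qed
    fix r assume r: "rat_eval (trace_poly n - [:2:]) r = 0"
    \<comment> \<open>A root of \<open>w^2 - r w + 1\<close>, so that
      \<open>r = w + 1 / w\<close>.\<close>
    define w where "w = (r + csqrt (r ^ 2 - 4)) / 2"
    have "w * (r - w) = (r ^ 2 - csqrt (r ^ 2 - 4) ^ 2) / 4"
      by (simp add: w_def power2_eq_square field_simps)
    hence w: "w * (r - w) = 1" by simp
    hence "w \<noteq> 0" by auto
    with w have rw: "r = w + 1 / w" by (simp add: field_simps)
    have wn: "w ^ n = 1" using r \<open>w \<noteq> 0\<close> unfolding rw by (intro unity)
    then obtain k where "w = \<zeta> ^ k" unfolding \<zeta>_def by (rule cis_unity_powers[OF n])
    hence "r \<in> rat_adjoin ?\<theta>" using trace[of k] by (simp add: rw)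
    thus "r \<in> real_cyclotomic_field n \<and> r \<in> \<real>" using unity_real[OF wn] K by (simp add: rw)
  qed
qed

text \<open>Writing \<open>z^n - 1\<close> as \<open>(z - 1) Q(z)\<close>, the derivative at 1 is
  \<open>n\<close> on one side and \<open>Q(1)\<close> on the other.\<close>

lemma prod_one_minus_roots_of_unity:
  assumes n: "n > 0"
  shows "(\<Prod>z | z ^ n = 1 \<and> z \<noteq> 1. 1 - z) = (of_nat n :: complex)"
proof -
  define P :: "complex poly" where "P = Polynomial.monom 1 n - 1"
  define Q where "Q = (\<Prod>z | z ^ n = 1 \<and> z \<noteq> 1. [:- z, 1 :: complex:])"
  have ev: "poly P z = z ^ n - 1" for z by (simp add: P_def poly_monom)
  have dev: "poly (pderiv P) z = of_nat n * z ^ (n - 1)" for z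
    by (simp add: P_def pderiv_diff pderiv_monom poly_monom)
  have "rsquarefree P"
    unfolding rsquarefree_roots
  proof (intro allI notI)
    fix z assume z: "poly P z = 0 \<and> poly (pderiv P) z = 0"
    hence "z ^ n = 1" by (simp add: ev)
    moreover have "z = 0" using z n by (simp add: dev)
    ultimately show False using n by (simp add: power_0_left)
  qed
  hence decomp: "Polynomial.smult (lead_coeff P) (\<Prod>z | poly P z = 0. [:- z, 1:]) = P"
    by (rule complex_poly_decompose_rsquarefree)
  have "degree P = degree (Polynomial.monom 1 n + (- 1) :: complex poly)" by (simp add: P_def)
  also have "\<dots> = n" using n by (subst degree_add_eq_left) (simp_all add: degree_monom_eq)
  finally have lead: "lead_coeff P = 1" using n by (simp add: P_def)
  have roots: "{z. poly P z = 0} = insert 1 {z. z ^ n = 1 \<and> z \<noteq> 1}" by (auto simp: ev)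
  have "finite {z :: complex. z ^ n = 1 \<and> z \<noteq> 1}"
    using finite_subset[OF _ finite_roots_unity[of n], of "{z :: complex. z ^ n = 1 \<and> z \<noteq> 1}"] n by auto
  hence "(\<Prod>z\<in>insert 1 {z. z ^ n = 1 \<and> z \<noteq> 1}. [:- z, 1:]) = [:- 1, 1:] * Q"
    unfolding Q_def by (rule prod.insert) simp
  hence "P = [:- 1, 1:] * Q" using decomp unfolding lead roots by simp
  hence "poly (pderiv P) 1 = poly (pderiv ([:- 1, 1:] * Q)) 1" by (rule arg_cong)
  also have "\<dots> = poly Q 1" unfolding pderiv_mult by (simp add: pderiv_pCons)
  finally have "poly (pderiv P) 1 = poly Q 1" .
  thus ?thesis by (simp add: dev Q_def poly_prod)
qed

text \<open>A product replaces the Gauss sum: \<open>p\<close> is the product of all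
  \<open>1 - \<eta> ^ j\<close>, each pair \<open>j\<close>, \<open>p - j\<close> contributes minus
  a square, and the number \<open>m\<close> of pairs is odd.\<close>

lemma sqrt_minus_prime_in_cyclotomic_field:
  assumes p: "prime p" "[p = 3] (mod 4)" "p dvd n" and n: "n > 0"
  obtains s where "s \<in> rat_adjoin (cis (2 * pi / real n))" "s ^ 2 = - of_nat p"
proof -
  have "p mod 4 = 3" using p(2) by (simp add: cong_def)
  define m where "m = (p - 1) div 2"
  have m: "odd m" "p = 2 * m + 1" using \<open>p mod 4 = 3\<close> unfolding m_def by presburger+
  obtain k where k: "n = p * k" using p(3) by auto
  define \<eta> where "\<eta> = cis (2 * pi / real p)"
  have \<eta>: "\<eta> = cis (2 * pi / real n) ^ k" using n by (simp add: \<eta>_def k Complex.DeMoivre)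
  have \<eta>p: "\<eta> ^ p = 1" using prime_gt_0_nat[OF p(1)] by (simp add: \<eta>_def Complex.DeMoivre)
  have \<eta>K: "\<eta> ^ j \<in> rat_adjoin (cis (2 * pi / real n))" for j
    unfolding \<eta> by (intro rat_adjoin_power rat_adjoin_generator)
  have bij: "bij_betw (\<lambda>j. \<eta> ^ j) {1..2 * m} {z. z ^ p = 1 \<and> z \<noteq> 1}"
  proof -
    have "bij_betw (\<lambda>j. \<eta> ^ j) {..<p} {z. z ^ p = 1}"
      using bij_betw_roots_unity[OF prime_gt_0_nat[OF p(1)]]
      by (simp add: \<eta>_def Complex.DeMoivre mult_ac)
    hence "bij_betw (\<lambda>j. \<eta> ^ j) ({..<p} - {0}) ({z. z ^ p = 1} - (\<lambda>j. \<eta> ^ j) ` {0})"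
      by (rule bij_betw_DiffI) (use m in \<open>auto simp: bij_betw_def\<close>)
    moreover have "{..<p} - {0} = {1..2 * m}" using m(2) by auto
    moreover have "{z :: complex. z ^ p = 1} - (\<lambda>j. \<eta> ^ j) ` {0} = {z. z ^ p = 1 \<and> z \<noteq> 1}" by auto
    ultimately show ?thesis by simp
  qed
  \<comment> \<open>As \<open>2 * (m + 1) = p + 1\<close>, the first factor is a square root of
    \<open>\<eta> ^ (p - j)\<close>, the inverse of \<open>\<eta> ^ j\<close>.\<close>
  define c where "c = (\<lambda>j. \<eta> ^ ((p - j) * (m + 1)) * (1 - \<eta> ^ j))"
  have pair: "(1 - \<eta> ^ j) * (1 - \<eta> ^ (p - j)) = - (c j ^ 2)" if "j \<in> {1..m}" for j
  proof -
    have "i * (m + 1) * 2 = i * p + i" for i by (simp add: m(2) algebra_simps)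
    hence "(\<eta> ^ ((p - j) * (m + 1))) ^ 2 = \<eta> ^ ((p - j) * p) * \<eta> ^ (p - j)"
      by (simp only: flip: power_mult power_add)
    also have "\<eta> ^ ((p - j) * p) = 1" by (metis \<eta>p mult.commute power_mult power_one)
    finally have 1: "(\<eta> ^ ((p - j) * (m + 1))) ^ 2 = \<eta> ^ (p - j)" by simp
    have "j \<le> p" using that m(2) by simp
    hence 2: "\<eta> ^ (p - j) * \<eta> ^ j = 1" using \<eta>p by (simp flip: power_add)
    have "c j ^ 2 = \<eta> ^ (p - j) * (1 - \<eta> ^ j) ^ 2" unfolding c_def power_mult_distrib 1 ..
    also have "\<dots> = \<eta> ^ (p - j) - 2 * (\<eta> ^ (p - j) * \<eta> ^ j) + (\<eta> ^ (p - j) * \<eta> ^ j) * \<eta> ^ j"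
      by (simp add: power2_eq_square algebra_simps)
    also have "\<dots> = - ((1 - \<eta> ^ j) * (1 - \<eta> ^ (p - j)))" unfolding 2 using 2 by (simp add: algebra_simps)
    finally show ?thesis by simp
  qed
  have "of_nat p = (\<Prod>z | z ^ p = 1 \<and> z \<noteq> 1. 1 - z :: complex)"
    using prod_one_minus_roots_of_unity[OF prime_gt_0_nat[OF p(1)]] by simp
  also have "\<dots> = (\<Prod>j\<in>{1..2 * m}. 1 - \<eta> ^ j)"
    by (rule prod.reindex_bij_betw[OF bij, symmetric])
  also have "{1..2 * m} = {1..m} \<union> {m + 1..2 * m}" by auto
  also have "(\<Prod>j\<in>\<dots>. 1 - \<eta> ^ j) = (\<Prod>j\<in>{1..m}. 1 - \<eta> ^ j) * (\<Prod>j\<in>{m + 1..2 * m}. 1 - \<eta> ^ j)"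
    by (rule prod.union_disjoint) auto
  also have "(\<Prod>j\<in>{m + 1..2 * m}. 1 - \<eta> ^ j) = (\<Prod>j\<in>{1..m}. 1 - \<eta> ^ (p - j))"
    by (rule prod.reindex_bij_witness[of _ "\<lambda>j. p - j" "\<lambda>j. p - j"]) (use m(2) in auto)
  also have "(\<Prod>j\<in>{1..m}. 1 - \<eta> ^ j) * \<dots> = (\<Prod>j\<in>{1..m}. - (c j ^ 2))"
    unfolding prod.distrib[symmetric] by (rule prod.cong[OF refl pair])
  also have "\<dots> = - ((\<Prod>j\<in>{1..m}. c j) ^ 2)"
    using m(1) by (simp add: prod_uminus prod_power_distrib)
  finally have "(\<Prod>j\<in>{1..m}. c j) ^ 2 = - of_nat p" by simp
  moreover have "(\<Prod>j\<in>{1..m}. c j) \<in> rat_adjoin (cis (2 * pi / real n))"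
    unfolding c_def by (intro rat_adjoin_prod rat_adjoin_mult rat_adjoin_diff \<eta>K rat_adjoin_1)
  ultimately show ?thesis using that by blast
qed

text \<open>The product of square roots of \<open>- p\<close> and \<open>- r\<close> squares to
  \<open>p * r\<close>, hence is plus or minus the real root.\<close>

lemma sqrt_in_real_cyclotomic_field:
  assumes p: "prime p" "[p = 3] (mod 4)" "p dvd n" and r: "prime r" "[r = 3] (mod 4)" "r dvd n" and n: "n > 0"
  shows "complex_of_real (sqrt (real (p * r))) \<in> real_cyclotomic_field n"
proof -
  let ?L = "rat_adjoin (cis (2 * pi / real n))"
  obtain s where s: "s \<in> ?L" "s ^ 2 = - of_nat p" by (rule sqrt_minus_prime_in_cyclotomic_field[OF p n])
  obtain t where t: "t \<in> ?L" "t ^ 2 = - of_nat r" by (rule sqrt_minus_prime_in_cyclotomic_field[OF r n])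
  have "(s * t) ^ 2 = complex_of_real (sqrt (real (p * r))) ^ 2"
    by (simp add: power_mult_distrib s t flip: of_real_power)
  hence "complex_of_real (sqrt (real (p * r))) = s * t \<or> complex_of_real (sqrt (real (p * r))) = - (s * t)"
    by (auto simp: power2_eq_iff)
  moreover have "s * t \<in> ?L" "- (s * t) \<in> ?L" using s t by (auto intro: rat_adjoin_mult rat_adjoin_uminus)
  ultimately have "complex_of_real (sqrt (real (p * r))) \<in> ?L" by auto
  moreover have "cyclotomic_field n = ?L" by (auto simp: cyclotomic_field_def rat_adjoin_def)
  ultimately show ?thesis by (simp add: real_cyclotomic_field_def)
qed

section \<open>Primes congruent to 3 modulo 4\<close>

text \<open>Count arcs: if every indegree were at most \<open>t - 1\<close>, there would be at most
  \<open>2 t (t - 1)\<close> arcs, fewer than the \<open>t (2 t - 1)\<close> pairs of vertices, each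
  of which carries one.\<close>

lemma tournament_large_indegree:
  assumes A: "finite A" "card A = 2 * t" "t \<ge> 1"
    and R: "\<And>p q. p \<in> A \<Longrightarrow> q \<in> A \<Longrightarrow> p \<noteq> q \<Longrightarrow> R p q \<or> R q p"
  shows "\<exists>q\<in>A. t \<le> card {p \<in> A. p \<noteq> q \<and> R p q}"
proof (rule ccontr)
  assume "\<not> ?thesis"
  hence small: "card {p \<in> A. p \<noteq> q \<and> R p q} \<le> t - 1" if "q \<in> A" for q
    using that by fastforce
  define S where "S = Sigma A (\<lambda>q. {p \<in> A. p \<noteq> q \<and> R p q})"
  have fS: "finite S" using A(1) by (simp add: S_def)
  have "card S = (\<Sum>q\<in>A. card {p \<in> A. p \<noteq> q \<and> R p q})"
    unfolding S_def using A(1) by (intro card_SigmaI) auto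
  also have "\<dots> \<le> (\<Sum>q\<in>A. t - 1)" using small by (intro sum_mono)
  finally have S: "card S \<le> 2 * t * (t - 1)" using A(2) by simp
  have "A \<times> A \<subseteq> S \<union> prod.swap ` S \<union> (\<lambda>a. (a, a)) ` A"
  proof
    fix z assume "z \<in> A \<times> A"
    then obtain q p where z: "z = (q, p)" "q \<in> A" "p \<in> A" by auto
    show "z \<in> S \<union> prod.swap ` S \<union> (\<lambda>a. (a, a)) ` A"
      using R[OF z(2,3)] z by (cases "p = q") (auto simp: S_def image_iff)
  qed
  hence "card (A \<times> A) \<le> card (S \<union> prod.swap ` S \<union> (\<lambda>a. (a, a)) ` A)"
    using fS A(1) by (intro card_mono) auto
  also have "\<dots> \<le> card S + card S + card A"
    using card_Un_le[of "S \<union> prod.swap ` S" "(\<lambda>a. (a, a)) ` A"] card_Un_le[of S "prod.swap ` S"]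
      card_image_le[OF fS, of prod.swap] card_image_le[OF A(1), of "\<lambda>a. (a, a)"] by linarith
  also have "\<dots> \<le> 2 * (2 * t * (t - 1)) + 2 * t" using S A(2) by simp
  finally have "(2 * t) * (2 * t) \<le> 2 * (2 * t * (t - 1)) + 2 * t" using A(2) by (simp add: card_cartesian_product)
  moreover obtain k where "t = Suc k" using A(3) by (cases t) auto
  ultimately show False by simp
qed

text \<open>Both \<open>(p - 1) div 2\<close> and \<open>(q - 1) div 2\<close> are odd, so
  reciprocity gives the two Legendre symbols the product -1, and one of them is 1.\<close>

lemma QuadRes_or_QuadRes_3_mod_4:
  fixes p q :: nat
  assumes "prime p" "prime q" "[p = 3] (mod 4)" "[q = 3] (mod 4)" "p \<noteq> q"
  shows "QuadRes (int q) (int p) \<or> QuadRes (int p) (int q)"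
proof -
  have m: "p mod 4 = 3" "q mod 4 = 3" using assms by (simp_all add: cong_def)
  have odd: "odd ((m - 1) div 2)" "2 < m" if "m mod 4 = 3" for m :: nat
    using that by presburger+
  have "Legendre (int p) (int q) * Legendre (int q) (int p) = (- 1) ^ ((p - 1) div 2 * ((q - 1) div 2))"
    using Quadratic_Reciprocity[of p q] assms odd m by simp
  hence "Legendre (int p) (int q) * Legendre (int q) (int p) = - 1"
    using odd[OF m(1)] odd[OF m(2)] by simp
  thus ?thesis by (auto simp: Legendre_def split: if_splits)
qed

lemma ex_dominated_primes_3_mod_4:
  fixes n t :: nat
  assumes "t \<ge> 1" "n > 0" "card {p :: nat. prime p \<and> p dvd n \<and> [p = 3] (mod 4)} \<ge> 2 * t"
  obtains P q where "finite P" "card P = t" "q \<notin> P" "prime q" "[q = 3] (mod 4)" "q dvd n"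
    "\<And>p. p \<in> P \<Longrightarrow> prime p \<and> p dvd n \<and> [p = 3] (mod 4) \<and> QuadRes (int q) (int p)"
proof -
  obtain A where A: "A \<subseteq> {p :: nat. prime p \<and> p dvd n \<and> [p = 3] (mod 4)}" "card A = 2 * t" "finite A"
    using obtain_subset_with_card_n[OF assms(3)] by blast
  have "\<exists>q\<in>A. t \<le> card {p \<in> A. p \<noteq> q \<and> QuadRes (int q) (int p)}"
    using A QuadRes_or_QuadRes_3_mod_4 by (intro tournament_large_indegree[OF A(3,2) assms(1)]) blast
  then obtain q where q: "q \<in> A" "t \<le> card {p \<in> A. p \<noteq> q \<and> QuadRes (int q) (int p)}" by blast
  obtain P where P: "P \<subseteq> {p \<in> A. p \<noteq> q \<and> QuadRes (int q) (int p)}" "card P = t" "finite P"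
    using obtain_subset_with_card_n[OF q(2)] by blast
  show ?thesis by (rule that[of P q]) (use P q A in auto)
qed

text \<open>Euclid's argument with \<open>4 * \<Prod>?S - 1\<close>: a number that is 3 modulo 4 has
  a prime factor that is 3 modulo 4.\<close>

lemma infinite_primes_3_mod_4: "infinite {p :: nat. prime p \<and> [p = 3] (mod 4)}"
proof
  let ?S = "{p :: nat. prime p \<and> [p = 3] (mod 4)}"
  assume fin: "finite ?S"
  define N where "N = 4 * \<Prod>?S - 1"
  have pos: "\<Prod>?S > 0" by (intro prod_pos) (auto intro: prime_gt_0_nat)
  have N4: "N mod 4 = 3"
  proof -
    obtain k where "\<Prod>?S = Suc k" using pos by (auto simp: gr0_conv_Suc)
    hence "N = 4 * k + 3" by (simp add: N_def)
    thus ?thesis by presburger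
  qed
  have "\<exists>p. prime p \<and> p dvd m \<and> [p = 3] (mod 4)" if "m mod 4 = 3" for m :: nat
    using that
  proof (induction m rule: less_induct)
    case (less m)
    hence "m \<noteq> 1" by auto
    then obtain p where p: "prime p" "p dvd m" using prime_factor_nat by blast
    then obtain k where k: "m = p * k" by auto
    have "(p mod 4) * (k mod 4) mod 4 = 3" using less(2) by (simp add: k mod_mult_eq)
    moreover have "p mod 4 \<in> {0, 1, 2, 3}" "k mod 4 \<in> {0, 1, 2, 3}" by auto
    ultimately consider "p mod 4 = 3" | "k mod 4 = 3" by auto
    thus ?case
    proof cases
      case 1
      with p show ?thesis by (auto simp: cong_def)
    next
      case 2
      have "m > 0" using less(2) by (intro Nat.gr0I) auto
      hence "k < m" using prime_gt_1_nat[OF p(1)] by (simp add: k)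
      from less(1)[OF this 2] show ?thesis by (auto simp: k)
    qed
  qed
  from this[OF N4] obtain p where p: "prime p" "p dvd N" "[p = 3] (mod 4)" by blast
  hence "p dvd \<Prod>?S" using fin by (intro dvd_prodI) auto
  hence "p dvd 4 * \<Prod>?S - N" using p(2) by (intro dvd_diff_nat) auto
  moreover have "4 * \<Prod>?S - N = 1" using pos unfolding N_def by simp
  ultimately show False using p(1) by simp
qed

section \<open>Annihilators of sign vectors\<close>

lemma prod_one_plus_eq_sum_Pow:
  fixes f :: "'a \<Rightarrow> 'b :: comm_semiring_1"
  assumes "finite A"
  shows "(\<Prod>x\<in>A. 1 + f x) = (\<Sum>X\<in>Pow A. \<Prod>x\<in>X. f x)"
  using prod_add[OF assms, of f "\<lambda>_. 1"] by (simp add: add.commute)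

text \<open>Sum \<open>\<Prod>i\<in>I. 1 + \<chi>\<^sub>i(X)\<close> over all \<open>X\<close>: it is \<open>2 ^ card I\<close> on the common kernel of the
  characters \<open>\<chi>\<^sub>i\<close>, and each nontrivial product of the \<open>\<chi>\<^sub>i\<close> sums to zero.\<close>
lemma card_common_kernel_le:
  fixes g :: "'i \<Rightarrow> 'e \<Rightarrow> real"
  assumes "finite E" "finite I"
    and g: "\<And>i \<sigma>. i \<in> I \<Longrightarrow> \<sigma> \<in> E \<Longrightarrow> g i \<sigma> \<in> {1, -1}"
    and indep: "\<And>T. T \<subseteq> I \<Longrightarrow> T \<noteq> {} \<Longrightarrow> \<exists>\<sigma>\<in>E. (\<Prod>i\<in>T. g i \<sigma>) = -1"
  shows "card {X \<in> Pow E. \<forall>i\<in>I. (\<Prod>\<sigma>\<in>X. g i \<sigma>) = 1} * 2 ^ card I \<le> 2 ^ card E"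
proof -
  let ?K = "{X \<in> Pow E. \<forall>i\<in>I. (\<Prod>\<sigma>\<in>X. g i \<sigma>) = 1}"
  let ?h = "\<lambda>X. \<Prod>i\<in>I. 1 + (\<Prod>\<sigma>\<in>X. g i \<sigma>)"
  have sign: "(\<Prod>\<sigma>\<in>X. g i \<sigma>) \<in> {1, -1}" if "X \<subseteq> E" "i \<in> I" for X i
    using finite_subset[OF that(1) assms(1)] that(1)
  proof (induction X rule: finite_induct)
    case (insert x X)
    thus ?case using g[OF that(2), of x] by auto
  qed simp
  have "real (card ?K * 2 ^ card I) = (\<Sum>X\<in>?K. ?h X)"
    by simp
  also have "\<dots> \<le> (\<Sum>X\<in>Pow E. ?h X)"
  proof (rule sum_mono2)
    fix X assume X: "X \<in> Pow E - ?K"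
    show "?h X \<ge> 0"
    proof (rule prod_nonneg)
      fix i assume "i \<in> I"
      with sign[of X i] X show "0 \<le> 1 + (\<Prod>\<sigma>\<in>X. g i \<sigma>)" by auto
    qed
  qed (use assms(1) in auto)
  also have "\<dots> = (\<Sum>X\<in>Pow E. \<Sum>T\<in>Pow I. \<Prod>i\<in>T. \<Prod>\<sigma>\<in>X. g i \<sigma>)"
    using assms(2) by (simp add: prod_one_plus_eq_sum_Pow)
  also have "\<dots> = (\<Sum>T\<in>Pow I. \<Sum>X\<in>Pow E. \<Prod>\<sigma>\<in>X. \<Prod>i\<in>T. g i \<sigma>)"
    by (subst sum.swap) (simp add: prod.swap[of _ _ "_ :: 'i set"])
  also have "\<dots> = (\<Sum>T\<in>Pow I. \<Prod>\<sigma>\<in>E. 1 + (\<Prod>i\<in>T. g i \<sigma>))"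
    using assms(1) by (simp add: prod_one_plus_eq_sum_Pow)
  also have "\<dots> = (\<Sum>T\<in>Pow I. if T = {} then 2 ^ card E else 0)"
  proof (intro sum.cong refl)
    fix T assume T: "T \<in> Pow I"
    show "(\<Prod>\<sigma>\<in>E. 1 + (\<Prod>i\<in>T. g i \<sigma>)) = (if T = {} then 2 ^ card E else 0)"
    proof (cases "T = {}")
      case False
      then obtain \<sigma> where "\<sigma> \<in> E" "(\<Prod>i\<in>T. g i \<sigma>) = -1" using indep T by blast
      hence "\<exists>\<sigma>\<in>E. 1 + (\<Prod>i\<in>T. g i \<sigma>) = 0" by (intro bexI[of _ \<sigma>]) simp_all
      from prod_zero[OF assms(1) this] show ?thesis using False by simp
    qed simp
  qed
  also have "\<dots> = 2 ^ card E" using assms(2) by simp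
  finally show ?thesis by (metis (mono_tags, lifting) of_nat_le_iff of_nat_numeral of_nat_power)
qed

interpretation bit_vs: vector_space bit_scale
  by unfold_locales (auto simp: bit_scale_def fun_eq_iff algebra_simps)

text \<open>A dimension bound by counting. Each \<open>g i\<close> encodes a linear functional,
  written multiplicatively: a vector goes to the product of \<open>g i\<close> over its support. The
  subset sums of a basis have distinct supports in the common kernel, whose size is bounded by
  \<open>card_common_kernel_le\<close>.\<close>

lemma dim_sign_vectors_le:
  fixes g :: "'i \<Rightarrow> (complex \<Rightarrow> real) \<Rightarrow> real"
  assumes "finite E" "finite I"
    and g: "\<And>i \<sigma>. i \<in> I \<Longrightarrow> \<sigma> \<in> E \<Longrightarrow> g i \<sigma> \<in> {1, -1}"
    and indep: "\<And>T. T \<subseteq> I \<Longrightarrow> T \<noteq> {} \<Longrightarrow> \<exists>\<sigma>\<in>E. (\<Prod>i\<in>T. g i \<sigma>) = -1"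
    and supp: "\<And>v \<sigma>. v \<in> V \<Longrightarrow> \<sigma> \<notin> E \<Longrightarrow> v \<sigma> = 0"
    and ker: "\<And>v i. v \<in> V \<Longrightarrow> i \<in> I \<Longrightarrow> (\<Prod>\<sigma> | \<sigma> \<in> E \<and> v \<sigma> = 1. g i \<sigma>) = 1"
  shows "bit_vs.dim V + card I \<le> card E"
proof -
  obtain B where B: "B \<subseteq> V" "bit_vs.independent B" "V \<subseteq> bit_vs.span B" "card B = bit_vs.dim V"
    by (rule bit_vs.basis_exists)
  \<comment> \<open>For an infinite basis \<open>card B\<close> is 0 by convention, so
    \<open>dim\<close> is 0 and the empty set has the right cardinality.\<close>
  obtain C where C: "C \<subseteq> V" "bit_vs.independent C" "card C = bit_vs.dim V" "finite C"
  proof (cases "finite B")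
    case False
    thus ?thesis using that[of "{}"] B by (simp add: bit_vs.independent_empty)
  qed (use that[of B] B in auto)
  define \<psi> where "\<psi> = (\<lambda>i (v :: (complex \<Rightarrow> real) \<Rightarrow> bit). \<Prod>\<sigma>\<in>E. if v \<sigma> = 1 then g i \<sigma> else 1)"
  have \<psi>: "\<psi> i v = (\<Prod>\<sigma> | \<sigma> \<in> E \<and> v \<sigma> = 1. g i \<sigma>)" for i v
    unfolding \<psi>_def using assms(1) by (rule prod.inter_filter[symmetric])
  have \<psi>_add: "\<psi> i (v + w) = \<psi> i v * \<psi> i w" if "i \<in> I" for i v w
    unfolding \<psi>_def prod.distrib[symmetric]
  proof (intro prod.cong refl)
    fix \<sigma> assume "\<sigma> \<in> E"
    thus "(if (v + w) \<sigma> = 1 then g i \<sigma> else 1) = (if v \<sigma> = 1 then g i \<sigma> else 1) * (if w \<sigma> = 1 then g i \<sigma> else 1)"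
      using g[OF that, of \<sigma>] by (cases "v \<sigma>"; cases "w \<sigma>") auto
  qed
  have sums: "\<psi> i (\<Sum>S) = 1" if "i \<in> I" "S \<subseteq> C" for i S
    using finite_subset[OF that(2) C(4)] that(2)
  proof (induction S rule: finite_induct)
    case empty
    show ?case by (simp add: \<psi>_def)
  next
    case (insert v S)
    thus ?case using C(1) supp ker[OF _ that(1)] \<psi>_add[OF that(1)] by (auto simp: \<psi>)
  qed
  have supps: "(\<Sum>S) \<sigma> = 0" if "S \<subseteq> C" "\<sigma> \<notin> E" for S \<sigma>
    using finite_subset[OF that(1) C(4)] that(1)
  proof (induction S rule: finite_induct)
    case (insert v S)
    thus ?case using C(1) supp that(2) by auto
  qed simp
  let ?K = "{X \<in> Pow E. \<forall>i\<in>I. (\<Prod>\<sigma>\<in>X. g i \<sigma>) = 1}"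
  have "inj_on (\<lambda>S. {\<sigma> \<in> E. (\<Sum>S) \<sigma> = 1}) (Pow C)"
  proof (rule inj_onI)
    fix S T assume ST: "S \<in> Pow C" "T \<in> Pow C" and eq: "{\<sigma> \<in> E. (\<Sum>S) \<sigma> = 1} = {\<sigma> \<in> E. (\<Sum>T) \<sigma> = 1}"
    have "(\<Sum>S) \<sigma> = (\<Sum>T) \<sigma>" for \<sigma>
    proof (cases "\<sigma> \<in> E")
      case True
      hence "(\<Sum>S) \<sigma> = 1 \<longleftrightarrow> (\<Sum>T) \<sigma> = 1" using eq by blast
      thus ?thesis by (cases "(\<Sum>S) \<sigma>"; cases "(\<Sum>T) \<sigma>") simp_all
    qed (use supps ST in auto)
    hence ST_eq: "\<Sum>S = \<Sum>T" by auto
    show "S = T"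
    proof (rule ccontr)
      assume "S \<noteq> T"
      \<comment> \<open>Over two elements the sum of the two indicators is that of the symmetric
        difference; it gives a nontrivial relation when \<open>S \<noteq> T\<close>.\<close>
      define u :: "((complex \<Rightarrow> real) \<Rightarrow> bit) \<Rightarrow> bit" where "u = (\<lambda>v. of_bool (v \<in> S) + of_bool (v \<in> T))"
      have half: "(\<Sum>v\<in>C. bit_scale (of_bool (v \<in> Z)) v) = \<Sum>Z" if "Z \<in> Pow C" for Z
      proof -
        have "(\<Sum>v\<in>C. bit_scale (of_bool (v \<in> Z)) v) = (\<Sum>v\<in>C. if v \<in> Z then v else 0)"
          by (intro sum.cong) (auto simp: bit_scale_def fun_eq_iff)
        also have "\<dots> = \<Sum>(C \<inter> Z)" using C(4) by (simp add: sum.inter_restrict)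
        also have "C \<inter> Z = Z" using that by blast
        finally show ?thesis .
      qed
      have "(\<Sum>v\<in>C. bit_scale (u v) v) = \<Sum>S + \<Sum>T"
        by (simp only: u_def bit_vs.scale_left_distrib sum.distrib half[OF ST(1)] half[OF ST(2)])
      also have "\<dots> = 0" unfolding ST_eq by (simp add: fun_eq_iff)
      finally have "(\<Sum>v\<in>C. bit_scale (u v) v) = 0" .
      moreover have "\<exists>v\<in>C. u v \<noteq> 0" using \<open>S \<noteq> T\<close> ST by (auto simp: u_def)
      ultimately have "bit_vs.dependent C" unfolding bit_vs.dependent_finite[OF C(4)] by blast
      with C(2) show False by simp
    qed
  qed
  moreover have "(\<lambda>S. {\<sigma> \<in> E. (\<Sum>S) \<sigma> = 1}) ` Pow C \<subseteq> ?K"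
    using sums by (auto simp flip: \<psi>)
  ultimately have "card (Pow C) \<le> card ?K" using assms(1) by (intro card_inj_on_le) auto
  hence "2 ^ card C * 2 ^ card I \<le> card ?K * (2 ^ card I :: nat)" using C(4) by (simp add: card_Pow)
  also have "\<dots> \<le> 2 ^ card E" using assms(1,2) g indep by (rule card_common_kernel_le)
  finally have "(2 :: nat) ^ (card C + card I) \<le> 2 ^ card E" by (simp add: power_add)
  thus ?thesis using C(3) by simp
qed

section \<open>The deficiency\<close>

text \<open>Any \<open>p\<close> in \<open>P\<close> divides the product exactly once, since it
  differs from \<open>p0\<close> and from the other members of \<open>P\<close>.\<close>

lemma prod_prime_multiples_not_square:
  fixes P :: "nat set" and p0 :: nat
  assumes fin: "finite P" and ne: "P \<noteq> {}" and pr: "\<And>p. p \<in> P \<Longrightarrow> prime p" and p0: "prime p0" "p0 \<notin> P"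
  shows "(\<Prod>p\<in>P. p0 * p) \<noteq> k ^ 2"
proof
  assume eq: "(\<Prod>p\<in>P. p0 * p) = k ^ 2"
  obtain p where p: "p \<in> P" using ne by blast
  define M where "M = p0 * (\<Prod>r\<in>P - {p}. p0 * r)"
  have M: "k ^ 2 = p * M" unfolding eq[symmetric] M_def using prod.remove[OF fin p, of "\<lambda>r. p0 * r"] by simp
  hence "p dvd k ^ 2" by simp
  hence "p dvd k" using pr[OF p] by (simp add: prime_dvd_power_iff)
  then obtain l where "k = p * l" by auto
  hence "p * M = (p * l) ^ 2" using M by (simp only:)
  also have "\<dots> = p * (p * l ^ 2)" by (simp add: power2_eq_square)
  finally have "p * M = p * (p * l ^ 2)" .
  hence "p dvd M" using prime_gt_0_nat[OF pr[OF p]] by simp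
  moreover have "\<not> p dvd p0" using primes_dvd_imp_eq[OF pr[OF p] p0(1)] p0(2) p by blast
  moreover have "\<not> p dvd (\<Prod>r\<in>P - {p}. p0 * r)"
  proof
    assume "p dvd (\<Prod>r\<in>P - {p}. p0 * r)"
    then obtain r where r: "r \<in> P" "r \<noteq> p" "p dvd p0 * r"
      using fin pr[OF p] by (auto simp: prime_dvd_prod_iff)
    hence "p dvd r" using \<open>\<not> p dvd p0\<close> pr[OF p] by (simp add: prime_dvd_mult_iff)
    thus False using primes_dvd_imp_eq[OF pr[OF p] pr[OF r(1)]] r(2) by blast
  qed
  ultimately show False using pr[OF p] by (simp add: M_def prime_dvd_mult_iff)
qed

context totally_real_galois
begin

text \<open>If all these sign products were 1, the product of the square roots would be fixed by
  every embedding, hence rational, and its square would be a perfect square.\<close>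

lemma ex_negative_sqrt_sign_prod:
  assumes fin: "finite P" and ne: "P \<noteq> {}" and pr: "\<And>p. p \<in> P \<Longrightarrow> prime p" and p0: "prime p0" "p0 \<notin> P"
    and K: "\<And>p. p \<in> P \<Longrightarrow> complex_of_real (sqrt (real (p0 * p))) \<in> K"
  shows "\<exists>\<sigma>\<in>E. (\<Prod>p\<in>P. sqrt_sign (p0 * p) \<sigma>) = - 1"
proof (rule ccontr)
  assume neg: "\<not> ?thesis"
  have pos: "p0 * p > 0" if "p \<in> P" for p
    using prime_gt_0_nat[OF pr[OF that]] prime_gt_0_nat[OF p0(1)] by simp
  define y where "y = (\<Prod>p\<in>P. sqrt (real (p0 * p)))"
  have "y \<in> \<rat>"
  proof (rule embedding_fixed_imp_rational)
    show "complex_of_real y \<in> K" unfolding y_def of_real_prod by (intro K_prod K)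
    fix \<sigma> assume \<sigma>: "\<sigma> \<in> E"
    have "\<bar>\<Prod>p\<in>P. sqrt_sign (p0 * p) \<sigma>\<bar> = (\<Prod>p\<in>P. 1)"
      unfolding abs_prod using embedding_sqrt(2)[OF \<sigma> K pos] by (intro prod.cong) fastforce+
    hence "(\<Prod>p\<in>P. sqrt_sign (p0 * p) \<sigma>) = 1" using neg \<sigma> by (auto simp: abs_if split: if_splits)
    moreover have "\<sigma> (complex_of_real y) = (\<Prod>p\<in>P. \<sigma> (complex_of_real (sqrt (real (p0 * p)))))"
      unfolding y_def of_real_prod by (rule embedding_prod[OF \<sigma> K])
    moreover have "\<dots> = (\<Prod>p\<in>P. sqrt_sign (p0 * p) \<sigma> * sqrt (real (p0 * p)))"
      by (rule prod.cong[OF refl embedding_sqrt(1)[OF \<sigma> K pos]])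
    ultimately show "\<sigma> (complex_of_real y) = y" by (simp only: prod.distrib y_def mult_1_left)
  qed
  moreover have y2: "y ^ 2 = of_int (int (\<Prod>p\<in>P. p0 * p))"
    unfolding y_def prod_power_distrib by (simp add: real_sqrt_mult power_mult_distrib)
  ultimately obtain k where "k ^ 2 = int (\<Prod>p\<in>P. p0 * p)" by (rule rational_square_int)
  hence "int (nat \<bar>k\<bar> ^ 2) = int (\<Prod>p\<in>P. p0 * p)" by simp
  hence "(\<Prod>p\<in>P. p0 * p) = nat \<bar>k\<bar> ^ 2" by (simp only: of_nat_eq_iff)
  with prod_prime_multiples_not_square[OF fin ne pr p0] show False by blast
qed

text \<open>Both sides are the parity of the number of \<open>\<sigma>\<close> with
  \<open>\<sigma> u < 0\<close> and \<open>sqrt_sign d \<sigma> = -1\<close>. This reads a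
  functional on signatures as the sign of a norm.\<close>

lemma prod_sqrt_sign_negative:
  assumes u: "u \<in> K" "u \<noteq> 0" and d: "d > 0" "complex_of_real (sqrt (real d)) \<in> K"
  shows "(\<Prod>\<sigma> | \<sigma> \<in> E \<and> \<sigma> u < 0. sqrt_sign d \<sigma>) = sgn (quadratic_norm d u (-1))"
proof -
  have "(\<Prod>\<sigma> | \<sigma> \<in> E \<and> \<sigma> u < 0. sqrt_sign d \<sigma>) = (\<Prod>\<sigma>\<in>E. if \<sigma> u < 0 then sqrt_sign d \<sigma> else 1)"
    using finite_embeddings by (rule prod.inter_filter)
  also have "\<dots> = (\<Prod>\<sigma>\<in>E. if sqrt_sign d \<sigma> = - 1 then sgn (\<sigma> u) else 1)"
  proof (intro prod.cong refl)
    fix \<sigma> assume "\<sigma> \<in> E"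
    thus "(if \<sigma> u < 0 then sqrt_sign d \<sigma> else 1) = (if sqrt_sign d \<sigma> = - 1 then sgn (\<sigma> u) else 1)"
      using embedding_sqrt(2)[of \<sigma> d] d embedding_eq_0_iff[of \<sigma> u] u by (auto simp: sgn_if)
  qed
  also have "\<dots> = (\<Prod>\<sigma> | \<sigma> \<in> E \<and> sqrt_sign d \<sigma> = - 1. sgn (\<sigma> u))"
    using finite_embeddings by (rule prod.inter_filter[symmetric])
  also have "\<dots> = sgn (quadratic_norm d u (-1))" unfolding quadratic_norm_def sgn_prod ..
  finally show ?thesis .
qed

lemma prod_minus_one_negative:
  assumes u: "u \<in> K" "u \<noteq> 0"
  shows "(\<Prod>\<sigma> | \<sigma> \<in> E \<and> \<sigma> u < 0. - 1) = sgn (\<Prod>\<sigma>\<in>E. \<sigma> u)"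
proof -
  have "(\<Prod>\<sigma> | \<sigma> \<in> E \<and> \<sigma> u < 0. - 1 :: real) = (\<Prod>\<sigma>\<in>E. if \<sigma> u < 0 then - 1 else 1)"
    using finite_embeddings by (rule prod.inter_filter)
  also have "\<dots> = (\<Prod>\<sigma>\<in>E. sgn (\<sigma> u))"
    using embedding_eq_0_iff[of _ u] u by (intro prod.cong) (auto simp: sgn_if)
  also have "\<dots> = sgn (\<Prod>\<sigma>\<in>E. \<sigma> u)" unfolding sgn_prod ..
  finally show ?thesis .
qed

lemma deficiency_ge:
  assumes P: "finite P" "P \<noteq> {}" "q \<notin> P" and q: "prime q" "[q = 3] (mod 4)"
    and pr: "\<And>p. p \<in> P \<Longrightarrow> prime p" "\<And>p. p \<in> P \<Longrightarrow> [p = 3] (mod 4)" "\<And>p. p \<in> P \<Longrightarrow> QuadRes (int q) (int p)"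
    and K: "\<And>p r. p \<in> insert q P \<Longrightarrow> r \<in> insert q P \<Longrightarrow> complex_of_real (sqrt (real (p * r))) \<in> K"
  shows "deficiency K \<ge> card P"
proof -
  obtain p0 where p0: "p0 \<in> P" using P(2) by blast
  have pos: "p0 * p > 0" if "p \<in> P" for p
    using prime_gt_0_nat[OF pr(1)[OF that]] prime_gt_0_nat[OF pr(1)[OF p0]] by simp
  \<comment> \<open>The character of \<open>p0 * p0\<close> would be trivial, so the index
    \<open>p0\<close> is given to the functional for the sign of the full norm.\<close>
  define g where "g = (\<lambda>p \<sigma>. if p = p0 then - 1 else sqrt_sign (p0 * p) \<sigma>)"
  have "bit_vs.dim (signature K ` units_of_field K) + card P \<le> card E"
  proof (rule dim_sign_vectors_le[OF finite_embeddings P(1), of g])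
    show "g p \<sigma> \<in> {1, -1}" if "p \<in> P" "\<sigma> \<in> E" for p \<sigma>
      using embedding_sqrt(2)[OF that(2) K pos] that(1) p0 by (auto simp: g_def)
    show "\<exists>\<sigma>\<in>E. (\<Prod>p\<in>T. g p \<sigma>) = - 1" if T: "T \<subseteq> P" "T \<noteq> {}" for T
    \<comment> \<open>If \<open>p0\<close> belongs to \<open>T\<close>, the inclusion embedding is a
      witness, as all its square root signs are 1. Otherwise only square root signs are
      involved.\<close>
    proof (cases "p0 \<in> T")
      case True
      let ?i = "\<lambda>x. if x \<in> K then Re x else 0"
      have "g p ?i = 1" if "p \<in> T - {p0}" for p
        using that T(1) pos[of p] K[of p0 p] p0 by (auto simp: g_def)
      hence "(\<Prod>p\<in>T - {p0}. g p ?i) = 1" by (intro prod.neutral) blast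
      moreover have "(\<Prod>p\<in>T. g p ?i) = g p0 ?i * (\<Prod>p\<in>T - {p0}. g p ?i)"
        using finite_subset[OF T(1) P(1)] True by (rule prod.remove)
      ultimately show ?thesis using id_embedding by (intro bexI[of _ ?i]) (simp_all add: g_def)
    next
      case False
      have "\<exists>\<sigma>\<in>E. (\<Prod>p\<in>T. sqrt_sign (p0 * p) \<sigma>) = - 1"
        using T False P(1) pr(1) p0 K by (intro ex_negative_sqrt_sign_prod) (auto intro: finite_subset)
      moreover have "(\<Prod>p\<in>T. g p \<sigma>) = (\<Prod>p\<in>T. sqrt_sign (p0 * p) \<sigma>)" for \<sigma>
        using False by (intro prod.cong) (auto simp: g_def)
      ultimately show ?thesis by simp
    qed
    show "v \<sigma> = 0" if "v \<in> signature K ` units_of_field K" "\<sigma> \<notin> E" for v \<sigma>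
      using that by (auto simp: signature_def)
    show "(\<Prod>\<sigma> | \<sigma> \<in> E \<and> v \<sigma> = 1. g p \<sigma>) = 1" if v: "v \<in> signature K ` units_of_field K" and p: "p \<in> P" for v p
    proof -
      obtain u where u: "u \<in> units_of_field K" and v: "v = signature K u" using v by blast
      have uK: "u \<in> K" "u \<noteq> 0" using u by (simp_all add: units_of_field_def)
      have "{\<sigma>. \<sigma> \<in> E \<and> v \<sigma> = 1} = {\<sigma>. \<sigma> \<in> E \<and> \<sigma> u < 0}" by (auto simp: v signature_def)
      moreover have "(\<Prod>\<sigma> | \<sigma> \<in> E \<and> \<sigma> u < 0. g p \<sigma>) = 1"
      proof (cases "p = p0")
        case True
        have "p0 \<noteq> q" using P(3) p0 by auto
        hence "(\<Prod>\<sigma>\<in>E. \<sigma> u) = 1"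
          using p0 pr q K by (intro unit_norm_eq_1[OF u, of p0 q]) auto
        thus ?thesis using prod_minus_one_negative[OF uK] by (simp add: g_def True)
      next
        case False
        have "p0 \<noteq> q" "p \<noteq> q" using P(3) p0 p by auto
        hence "quadratic_norm (p0 * p) u (-1) > 0"
          using p0 p pr q K False by (intro unit_quadratic_norm_pos[OF u, of p0 p q]) auto
        thus ?thesis using prod_sqrt_sign_negative[OF uK pos[OF p] K[of p0 p]] p0 p False by (simp add: g_def)
      qed
      ultimately show ?thesis by simp
    qed
  qed
  thus ?thesis unfolding deficiency_def unit_signature_rank_def by simp
qed

end

lemma deficiency_real_cyclotomic_field_ge:
  fixes t n :: nat
  assumes "t \<ge> 1" "n > 0" "2 * t \<le> card {p :: nat. prime p \<and> p dvd n \<and> [p = 3] (mod 4)}"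
  shows "t \<le> deficiency (real_cyclotomic_field n)"
proof -
  interpret totally_real_galois "real_cyclotomic_field n" "cis (2 * pi / real n) + 1 / cis (2 * pi / real n)"
    "trace_poly n - [:2:]"
    using assms(2) by (rule real_cyclotomic_field_totally_real_galois)
  obtain P q where P: "finite P" "card P = t" "q \<notin> P" and q: "prime q" "[q = 3] (mod 4)" "q dvd n"
    and pr: "\<And>p. p \<in> P \<Longrightarrow> prime p \<and> p dvd n \<and> [p = 3] (mod 4) \<and> QuadRes (int q) (int p)"
    using ex_dominated_primes_3_mod_4[OF assms] by metis
  have "P \<noteq> {}" using P(2) assms(1) by auto
  have "card P \<le> deficiency (real_cyclotomic_field n)"
    using P(1) \<open>P \<noteq> {}\<close> P(3) q(1,2)
  proof (rule deficiency_ge)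
    fix p r assume "p \<in> insert q P" "r \<in> insert q P"
    thus "complex_of_real (sqrt (real (p * r))) \<in> real_cyclotomic_field n"
      using q pr assms(2) by (intro sqrt_in_real_cyclotomic_field) auto
  qed (use pr in auto)
  with P(2) show ?thesis by simp
qed

theorem theorem6p12:
  "(\<forall>t n :: nat. t \<ge> 1 \<longrightarrow> n > 0 \<longrightarrow>
      card {p :: nat. prime p \<and> p dvd n \<and> [p = 3] (mod 4)} \<ge> 2 * t \<longrightarrow>
      deficiency (real_cyclotomic_field n) \<ge> t)
   \<and> (\<forall>m :: nat. \<exists>N :: nat. N > 0 \<and> deficiency (real_cyclotomic_field N) \<ge> m)"
proof (intro conjI allI impI)
  fix t n :: nat
  assume "t \<ge> 1" "n > 0" "card {p :: nat. prime p \<and> p dvd n \<and> [p = 3] (mod 4)} \<ge> 2 * t"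
  thus "deficiency (real_cyclotomic_field n) \<ge> t" by (rule deficiency_real_cyclotomic_field_ge)
next
  fix m :: nat
  show "\<exists>N :: nat. N > 0 \<and> deficiency (real_cyclotomic_field N) \<ge> m"
  \<comment> \<open>The first part requires \<open>t \<ge> 1\<close>, so 0 is split off; otherwise a
    product of \<open>2 * m\<close> primes that are 3 modulo 4 serves as \<open>N\<close>.\<close>
  proof (cases "m = 0")
    case False
    obtain A where A: "finite A" "card A = 2 * m" "A \<subseteq> {p :: nat. prime p \<and> [p = 3] (mod 4)}"
      using infinite_arbitrarily_large[OF infinite_primes_3_mod_4] by blast
    have N: "\<Prod>A > 0" using A(3) by (intro prod_pos) (auto intro: prime_gt_0_nat)
    have "A \<subseteq> {p. prime p \<and> p dvd \<Prod>A \<and> [p = 3] (mod 4)}"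
      using A by (auto intro: dvd_prodI)
    moreover have "finite {p. prime p \<and> p dvd \<Prod>A \<and> [p = 3] (mod 4)}"
      using N by (intro finite_subset[OF _ finite_divisors_nat[of "\<Prod>A"]]) auto
    ultimately have "2 * m \<le> card {p. prime p \<and> p dvd \<Prod>A \<and> [p = 3] (mod 4)}"
      using card_mono A(2) by metis
    hence "deficiency (real_cyclotomic_field (\<Prod>A)) \<ge> m"
      using False N by (intro deficiency_real_cyclotomic_field_ge) simp_all
    with N show ?thesis by blast
  qed auto
qed

end
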